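(* Let $E_T\subsetneq\mathbb T$ be a finite union of disjoint non-degenerate closed arcs, let $x\in\mathbb R$ with $e^{ix}\in\mathbb T\setminus E_T$, and let $n\ge1$. Then there exist an $n$-regular comb $\tilde\Pi$ and a conformal map $\tilde\tau$ of $\mathbb C_+$ onto $\tilde\Pi$ such that the polynomial $P_{n,e^{ix}}$ defined by $$P_{n,e^{ix}}(e^{iz})=e^{iz\frac n2}\cos\Big(\frac n2\tilde\tau(z)\Big)$$ is an extremal polynomial of the problem defining $A_n(e^{ix};E_T)$, so that $A_n(e^{ix};E_T)=|P'_{n,e^{ix}}(e^{ix})|$. Moreover, the set $\tilde E=\{e^{it}: t\in\mathbb R,\ \tilde\tau(t)\in\mathbb R\}$ (corresponding to the base of the comb) contains $E_T$, and for every $k=0,\dots,n-1$ at least one of the (possibly two different) points $e^{i\tilde\tau^{-1}(\frac{2\pi k}n\pm0)}$ belongs to $E_T$.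
   Context: $\mathcal P_n(E_T)$ is the set of complex polynomials of degree at most $n$ with $|P|\le1$ on $E_T$, and for $\zeta\notin E_T$, $A_n(\zeta;E_T)=\sup\{|P'(\zeta)|:P\in\mathcal P_n(E_T),\ P(\zeta)=0\}$. An $n$-regular comb is a domain of the form $\tilde\Pi=\mathbb C_+\setminus\bigcup_{j}\bigcup_{m\in\mathbb Z}\{\tilde\omega_j+2\pi m+i\eta:\eta\in(0,h_j]\}$ with finitely many $\tilde\omega_j\in[0,2\pi)$, $h_j>0$, such that $\frac n{2\pi}\tilde\omega_j\in\mathbb Z$ for all $j$. The conformal map $\tilde\tau:\mathbb C_+\to\tilde\Pi$ extends continuously to $\mathbb R$ (boundary correspondence), and $\tilde\tau^{-1}(c\pm0)$ denote the preimages of the two sides of the base point $c$ of a slit (a single point if there is no slit at $c$). *)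

theory Defs
  imports "HOL-Complex_Analysis.Complex_Analysis" "HOL-Computational_Algebra.Polynomial"
begin

definition circ_arc :: "real \<Rightarrow> real \<Rightarrow> complex set" where
  "circ_arc a b = {cis t | t. a \<le> t \<and> t \<le> b}"

definition finite_arc_union :: "complex set \<Rightarrow> bool" where
  "finite_arc_union E \<longleftrightarrow>
     (\<exists>(m::nat) (a::nat \<Rightarrow> real) b. m \<ge> 1 \<and>
        (\<forall>j<m. a j < b j \<and> b j - a j < 2 * pi) \<and>
        (\<forall>j<m. \<forall>l<m. j \<noteq> l \<longrightarrow> circ_arc (a j) (b j) \<inter> circ_arc (a l) (b l) = {}) \<and>
        E = (\<Union>j<m. circ_arc (a j) (b j)))"

definition Pn :: "nat \<Rightarrow> complex set \<Rightarrow> complex poly set" where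
  "Pn n E = {P. degree P \<le> n \<and> (\<forall>w\<in>E. norm (poly P w) \<le> 1)}"

definition A_n :: "nat \<Rightarrow> complex \<Rightarrow> complex set \<Rightarrow> real" where
  "A_n n \<zeta> E = Sup {norm (poly (pderiv P) \<zeta>) | P. P \<in> Pn n E \<and> poly P \<zeta> = 0}"

definition upper_half_plane :: "complex set" where
  "upper_half_plane = {z. Im z > 0}"

text \<open>A comb is given by a finite set S of slits (omega, h): base point omega in [0, 2 pi), height h > 0;
  the slits are repeated 2 pi periodically.\<close>
definition comb_domain :: "(real \<times> real) set \<Rightarrow> complex set" where
  "comb_domain S = upper_half_plane -
     (\<Union>(\<omega>, h)\<in>S. \<Union>m\<in>(\<int>::real set). {complex_of_real (\<omega> + 2 * pi * m) + \<i> * complex_of_real \<eta> | \<eta>. 0 < \<eta> \<and> \<eta> \<le> h})"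

definition regular_comb_data :: "nat \<Rightarrow> (real \<times> real) set \<Rightarrow> bool" where
  "regular_comb_data n S \<longleftrightarrow> finite S \<and>
     (\<forall>(\<omega>, h)\<in>S. 0 \<le> \<omega> \<and> \<omega> < 2 * pi \<and> h > 0 \<and> real n * \<omega> / (2 * pi) \<in> \<int>)"

end

theory Submission
  imports Defs "HOL-Computational_Algebra.Fundamental_Theorem_Algebra"
begin

text \<open>
  Write \<open>T z = exp (- i n z / 2) P (exp (i z))\<close>. Taking real parts, an extremal \<open>T\<close> may be assumed real on
  the real line. If \<open>T\<close> did not take the values \<open>\<plusminus>1\<close> with alternating signs at \<open>n\<close> points of
  \<open>E\<close> in \<open>(x, x + 2 pi)\<close>, there would be a product of \<open>n\<close> sines with a double zero at \<open>x\<close> and sign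
  opposite to \<open>T\<close> at all extremal points; adding a small multiple of it lowers the norm of \<open>T\<close> on \<open>E\<close>
  without changing the derivative at \<open>x\<close>, a contradiction.

  Alternation makes all zeros of \<open>cos (N arccos T)\<close> real for every \<open>N\<close>. Hence \<open>T\<close> omits \<open>[-1, 1]\<close> in
  the upper half-plane and lifts to \<open>T = cos \<Theta>\<close> with \<open>Im \<Theta> > 0\<close>. The logarithmic derivative
  \<open>- N tan (N \<Theta>) \<Theta>'\<close> of \<open>cos (N \<Theta>)\<close> has negative imaginary part, and \<open>tan (N \<Theta>)\<close> tends to \<open>i\<close>, so
  \<open>Re \<Theta>' > 0\<close>; therefore \<open>\<Theta>\<close> is injective and \<open>Re \<Theta>\<close> is monotone on the real line. Since
  \<open>cos \<Theta>\<close> is real there, the boundary curve runs along the real line and up and down vertical slits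
  over multiples of \<open>pi\<close>, and \<open>\<Theta>\<close> maps onto the complement of that curve. The comb map is \<open>2 \<Theta> / n\<close>.
\<close>

subsection \<open>Half-integer trigonometric polynomials\<close>

text \<open>The count of \<open>n\<close> alternation points fits twice. A perturbation must vanish
  doubly at \<open>x\<close>, which leaves \<open>n - 2\<close> free sine factors, so
  \<open>n\<close> alternation points on E can be forced. A shift by \<open>2 * pi\<close>
  multiplies T by \<open>(-1) ^ n\<close>, so the first point repeated one period later continues
  the alternation, and a period has \<open>n\<close> gaps. Each gap contributes \<open>N\<close>
  zeros of \<open>cos (N arccos T)\<close>, which exhausts the degree \<open>n * N\<close>. All
  \<open>N\<close> are used because \<open>N = 1\<close> controls only the product of the tangent of
  \<open>\<Theta>\<close> with \<open>\<Theta>'\<close>; the tangent disappears only in the limit. A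
  strict inequality could degenerate there, so the estimates carry an explicit gap proportional to
  the degree. Continuity of the comb map up to the real line is derived from
  \<open>cos \<Theta> = T\<close>, where T is entire. The alternation points are points of E over
  the base points of the comb, which is what the last assertion asks for.\<close>

definition trig :: "nat \<Rightarrow> complex poly \<Rightarrow> complex \<Rightarrow> complex" where
  "trig n P z = exp (- (\<i> * of_nat n * z / 2)) * poly P (exp (\<i> * z))"

lemma trig_holomorphic: "trig n P holomorphic_on A"
  unfolding trig_def by (intro holomorphic_intros) auto

lemma trig_continuous: "continuous_on A (trig n P)"
  using trig_holomorphic holomorphic_on_imp_continuous_on by blast

lemma poly_eq_trig: "poly P (exp (\<i> * z)) = exp (\<i> * of_nat n * z / 2) * trig n P z"
  by (simp add: trig_def exp_minus field_simps)

lemma norm_trig_of_real: "norm (trig n P (complex_of_real t)) = norm (poly P (cis t))"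
  by (simp add: trig_def norm_mult cis_conv_exp)

lemma trig_plus_2pi: "trig n P (z + 2 * of_real pi) = (-1) ^ n * trig n P z"
proof -
  have "exp (\<i> * (z + 2 * of_real pi)) = exp (\<i> * z) * exp (\<i> * (of_real pi * 2))"
    unfolding exp_add [symmetric] by (rule arg_cong [of _ _ exp]) (simp add: algebra_simps)
  hence "exp (\<i> * (z + 2 * of_real pi)) = exp (\<i> * z)" by simp
  moreover have "exp (- (\<i> * of_nat n * (z + 2 * of_real pi) / 2)) 
      = exp (- (\<i> * of_nat n * z / 2)) * exp (- (of_nat n * (\<i> * pi)))"
    unfolding exp_add [symmetric] by (rule arg_cong [of _ _ exp]) (simp add: field_simps)
  moreover have "exp (- (of_nat n * (\<i> * pi))) = (-1) ^ n"
  proof -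
    have "exp (- (of_nat n * (\<i> * pi))) = exp (of_nat n * (- (\<i> * pi)))" by simp
    also have "\<dots> = exp (- (\<i> * pi)) ^ n" by (rule exp_of_nat_mult)
    also have "exp (- (\<i> * pi)) = -1" by (simp add: exp_minus)
    finally show ?thesis .
  qed
  ultimately show ?thesis unfolding trig_def by simp
qed

lemma trig_add: "trig n (P + Q) z = trig n P z + trig n Q z"
  and trig_smult: "trig n (smult c P) z = c * trig n P z"
  by (simp_all add: trig_def algebra_simps)

section \<open>The complex cosine\<close>

lemma cos_eq_pm1_imp:
  fixes a :: complex
  assumes "cos a = 1 \<or> cos a = -1"
  obtains p :: int where "a = of_real (pi * of_int p)"
proof -
  have "(sin a)\<^sup>2 = 0"
    using assms by (auto simp: sin_squared_eq)
  hence "sin a = 0" by simp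
  then obtain p :: int where "a = of_int p * of_real pi"
    by (auto simp: sin_eq_0)
  thus thesis using that [of p] by (simp add: mult.commute)
qed

text \<open>Cosine maps vertical and horizontal lines to hyperbolas and ellipses with foci -1 and 1.
  Sum and difference of the focal distances recover \<open>cosh (Im a)\<close> and
  \<open>cos (Re a)\<close>; this carries continuity of T over to its phase.\<close>

lemma cmod_cos_pm1:
  fixes a :: complex
  shows "norm (cos a + 1) = cosh (Im a) + cos (Re a)"
    and "norm (cos a - 1) = cosh (Im a) - cos (Re a)"
proof -
  have c: "1 \<le> cosh (Im a)" by (rule cosh_real_ge_1)
  have sq: "(sinh (Im a))\<^sup>2 = (cosh (Im a))\<^sup>2 - 1" "(sin (Re a))\<^sup>2 = 1 - (cos (Re a))\<^sup>2"
    by (simp_all add: cosh_square_eq sin_squared_eq)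
  have re: "Re (cos a) = cos (Re a) * cosh (Im a)" by (simp add: Re_cos cosh_def scaleR_conv_of_real)
  have im: "Im (cos a) = - (sin (Re a) * sinh (Im a))" by (simp add: Im_cos sinh_def algebra_simps diff_divide_distrib)
  have cr: "-1 \<le> cos (Re a)" "cos (Re a) \<le> 1" by simp_all
  have ge: "0 \<le> cosh (Im a) + cos (Re a)" "0 \<le> cosh (Im a) - cos (Re a)" using c cr by linarith+
  have im2: "(Im (cos a))\<^sup>2 = (1 - (cos (Re a))\<^sup>2) * ((cosh (Im a))\<^sup>2 - 1)"
    using sq by (simp add: im power_mult_distrib)
  have "(norm (cos a + 1))\<^sup>2 = (cosh (Im a) + cos (Re a))\<^sup>2"
    unfolding cmod_power2 by (simp add: im2, simp add: re power2_eq_square algebra_simps)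
  thus "norm (cos a + 1) = cosh (Im a) + cos (Re a)"
    by (rule power2_eq_imp_eq) (use ge in simp_all)
  have "(norm (cos a - 1))\<^sup>2 = (cosh (Im a) - cos (Re a))\<^sup>2"
    unfolding cmod_power2 by (simp add: im2, simp add: re power2_eq_square algebra_simps)
  thus "norm (cos a - 1) = cosh (Im a) - cos (Re a)"
    by (rule power2_eq_imp_eq) (use ge in simp_all)
qed

text \<open>On the segment from -1 to 1 the focal distances add up to 2, which forces
  \<open>cosh (Im a) = 1\<close>. This will put the points of E on the base of the comb.\<close>

lemma Im_eq_0_of_cos:
  fixes a :: complex
  assumes "cos a \<in> \<real>" "norm (cos a) \<le> 1"
  shows "Im a = 0"
proof -
  obtain r where r: "cos a = of_real r" using assms Reals_cases by blast
  have r1: "\<bar>r\<bar> \<le> 1" using assms r by simp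
  have "norm (cos a + 1) = \<bar>r + 1\<bar>" "norm (cos a - 1) = \<bar>r - 1\<bar>"
    unfolding r by (metis norm_of_real of_real_1 of_real_add, metis norm_of_real of_real_1 of_real_diff)
  hence "cosh (Im a) = 1" using cmod_cos_pm1 [of a] r1 by linarith
  thus ?thesis by simp
qed

lemma cos_real_cases:
  fixes a :: complex
  assumes "cos a \<in> \<real>"
  shows "sin (Re a) = 0 \<or> Im a = 0"
  using assms by (auto simp: complex_is_Real_iff Im_cos)

subsection \<open>Polynomials with all roots on the unit circle\<close>

text \<open>The exact value is 1/2 - (1 - |w|^2) / (2 |w - a|^2), and the 8 comes from |w - a| being
  at most 2. The gap below 1/2 is kept because it must survive a limit.\<close>

lemma Re_div_diff_circle:
  fixes a w :: complex
  assumes "norm a = 1" "norm w < 1"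
  shows "Re (w / (w - a)) \<le> 1 / 2 - (1 - (norm w)\<^sup>2) / 8"
proof -
  have ne: "w \<noteq> a" using assms by auto
  have "norm (w - a) \<le> 2" using norm_triangle_ineq4 [of w a] assms by simp
  hence le4: "(norm (w - a))\<^sup>2 \<le> 4" using power_mono [of "norm (w - a)" 2 2] by simp
  have pos: "(norm (w - a))\<^sup>2 > 0" using ne by simp
  have a1: "(Re a)\<^sup>2 + (Im a)\<^sup>2 = 1" using assms by (metis cmod_power2 one_power2)
  have "Re (w / (w - a)) = (Re w * (Re w - Re a) + Im w * (Im w - Im a)) / (norm (w - a))\<^sup>2"
    by (simp add: Re_divide cmod_power2)
  also have "\<dots> = 1 / 2 - (1 - (norm w)\<^sup>2) / (2 * (norm (w - a))\<^sup>2)"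
  proof -
    have "(Re w * (Re w - Re a) + Im w * (Im w - Im a)) = ((norm (w - a))\<^sup>2 - (1 - (norm w)\<^sup>2)) / 2"
      using a1 unfolding cmod_power2 by (simp add: power2_eq_square algebra_simps)
    thus ?thesis using pos by (simp add: diff_divide_distrib)
  qed
  also have "\<dots> \<le> 1 / 2 - (1 - (norm w)\<^sup>2) / 8"
  proof -
    have "(1 - (norm w)\<^sup>2) \<ge> 0" using assms by (simp add: power_le_one)
    hence "(1 - (norm w)\<^sup>2) / 8 \<le> (1 - (norm w)\<^sup>2) / (2 * (norm (w - a))\<^sup>2)"
      using le4 pos by (intro divide_left_mono) auto
    thus ?thesis by linarith
  qed
  finally show ?thesis .
qed

text \<open>The logarithmic derivative times \<open>w\<close> is the sum of
  \<open>w / (w - a)\<close> over the roots with multiplicity, so the bound for one root is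
  multiplied by the degree.\<close>

lemma Re_log_deriv_poly_circle:
  fixes Q :: "complex poly"
  assumes "Q \<noteq> 0" "\<And>a. poly Q a = 0 \<Longrightarrow> norm a = 1" "norm w < 1"
  shows "Re (w * poly (pderiv Q) w / poly Q w) \<le> degree Q * (1 / 2 - (1 - (norm w)\<^sup>2) / 8)"
  using assms(1,2)
proof (induction "degree Q" arbitrary: Q)
  case 0
  then obtain c where "Q = [:c:]" by (metis degree_eq_zeroE)
  thus ?case by simp
next
  case (Suc d)
  obtain a where a: "poly Q a = 0"
    using fundamental_theorem_of_algebra [of Q] Suc.hyps(2) by (auto simp: constant_degree)
  hence na: "norm a = 1" using Suc.prems by blast
  from a obtain R where R: "Q = [:-a, 1:] * R" by (auto simp: poly_eq_0_iff_dvd)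
  have R0: "R \<noteq> 0" using Suc.prems R by auto
  have dR: "degree Q = Suc (degree R)" unfolding R using R0 by (subst degree_mult_eq) auto
  have rootsR: "norm b = 1" if "poly R b = 0" for b using Suc.prems(2) [of b] that R by simp
  have IH: "Re (w * poly (pderiv R) w / poly R w) \<le> degree R * (1 / 2 - (1 - (norm w)\<^sup>2) / 8)"
    using Suc.hyps dR R0 rootsR by auto
  have wa: "w - a \<noteq> 0" using na assms(3) by auto
  have Rw: "poly R w \<noteq> 0" using rootsR assms(3) by fastforce
  have "w * poly (pderiv Q) w / poly Q w = w / (w - a) + w * poly (pderiv R) w / poly R w"
    unfolding R pderiv_mult using wa Rw by (simp add: pderiv_pCons field_simps)
  hence "Re (w * poly (pderiv Q) w / poly Q w) = Re (w / (w - a)) + Re (w * poly (pderiv R) w / poly R w)"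
    by simp
  also have "\<dots> \<le> (1 / 2 - (1 - (norm w)\<^sup>2) / 8) + degree R * (1 / 2 - (1 - (norm w)\<^sup>2) / 8)"
    using IH Re_div_diff_circle [OF na assms(3)] by linarith
  finally show ?case unfolding dR of_nat_Suc distrib_right by simp
qed

lemma roots_eq_of_card:
  fixes Q :: "complex poly"
  assumes "Q \<noteq> 0" "degree Q \<le> d" "R \<subseteq> {w. poly Q w = 0}" "card R \<ge> d"
  shows "degree Q = d" "{w. poly Q w = 0} = R"
proof -
  have f: "finite {w. poly Q w = 0}" using assms poly_roots_finite by blast
  have "card R \<le> card {w. poly Q w = 0}" by (rule card_mono [OF f assms(3)])
  moreover have "card {w. poly Q w = 0} \<le> degree Q" by (rule card_poly_roots_bound [OF assms(1)])
  ultimately show "degree Q = d" using assms by linarith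
  have "card R = card {w. poly Q w = 0}" 
    using \<open>card R \<le> _\<close> \<open>card {w. poly Q w = 0} \<le> degree Q\<close> assms by linarith
  thus "{w. poly Q w = 0} = R" using card_subset_eq [OF f assms(3)] by simp
qed

subsection \<open>Real-part monotonicity and boundary limits\<close>

text \<open>The argument behind the Noshiro-Warschawski theorem: the factor \<open>b - a\<close>
  cancels in the derivative of \<open>g\<close>, and the real mean value theorem applies.\<close>

lemma Re_quotient_ge:
  fixes f :: "complex \<Rightarrow> complex"
  assumes "f holomorphic_on U" "open U" "closed_segment a b \<subseteq> U" "a \<noteq> b"
    and "\<And>z. z \<in> closed_segment a b \<Longrightarrow> Re (deriv f z) \<ge> c"
  shows "Re ((f b - f a) / (b - a)) \<ge> c"
proof -
  define g where "g s = Re (f (a + of_real s * (b - a)) / (b - a))" for s :: real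
  have seg: "a + of_real s * (b - a) \<in> closed_segment a b" if "0 \<le> s" "s \<le> 1" for s :: real
    using that by (auto simp: closed_segment_def scaleR_conv_of_real algebra_simps intro!: exI [of _ s])
  have der: "(g has_real_derivative Re (deriv f (a + of_real s * (b - a)))) (at s)" if "0 \<le> s" "s \<le> 1" for s
  proof -
    let ?z = "a + of_real s * (b - a)"
    have "(f has_field_derivative deriv f ?z) (at ?z)"
      using assms seg [OF that] holomorphic_derivI by blast
    moreover have "((\<lambda>s. a + s * (b - a)) has_field_derivative (b - a)) (at (of_real s))"
      by (auto intro!: derivative_eq_intros)
    ultimately have "((\<lambda>s. f (a + s * (b - a))) has_field_derivative (deriv f ?z * (b - a))) (at (of_real s))"
      by (rule DERIV_chain2)
    hence "((\<lambda>s. f (a + s * (b - a)) / (b - a)) has_field_derivative (deriv f ?z * (b - a)) / (b - a)) (at (of_real s))"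
      by (rule DERIV_cdivide)
    hence "((\<lambda>s. f (a + s * (b - a)) / (b - a)) has_field_derivative deriv f ?z) (at (of_real s))"
      using assms by simp
    thus ?thesis unfolding g_def by (rule has_field_derivative_Re [OF has_vector_derivative_real_field, unfolded o_def])
  qed
  have "\<exists>s. 0 < s \<and> s < 1 \<and> g 1 - g 0 = (1 - 0) * Re (deriv f (a + of_real s * (b - a)))"
    by (rule MVT2) (use der in auto)
  then obtain s where s: "0 < s" "s < 1" "g 1 - g 0 = Re (deriv f (a + of_real s * (b - a)))" by auto
  have "g 1 - g 0 = Re ((f b - f a) / (b - a))" by (simp add: g_def diff_divide_distrib)
  moreover have "c \<le> Re (deriv f (a + of_real s * (b - a)))"
    by (intro assms(5) seg) (use s in auto)
  ultimately show ?thesis using s by simp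
qed

text \<open>With midpoint m, the two differences are - A cos m + B sin m and - A cos m - B sin m. If
  both are small, so are A cos m and B sin m, and then cosine and sine of m are both at most 1/2 in
  absolute value. The bound \<open>\<eta>\<close> does not depend on \<open>p\<close>.\<close>

lemma cos_oscillation:
  fixes e :: real
  assumes "0 < e" "e \<le> 1"
  obtains \<eta> where "\<eta> > 0"
    "\<And>p. \<not> (\<bar>cos p - cos (p + e / 2)\<bar> \<le> \<eta> \<and> \<bar>cos (p + e) - cos (p + e / 2)\<bar> \<le> \<eta>)"
proof -
  define A where "A = 1 - cos (e / 2)"
  define B where "B = sin (e / 2)"
  have e2: "e / 2 < pi" using assms pi_gt3 by linarith
  have "cos (e / 2) < cos 0" using assms e2 by (intro cos_monotone_0_pi) auto
  hence A: "A > 0" by (simp add: A_def)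
  have B: "B > 0" unfolding B_def using assms e2 by (intro sin_gt_zero) auto
  define \<eta> where "\<eta> = min A B / 2"
  have \<eta>: "\<eta> > 0" using A B by (simp add: \<eta>_def)
  have "\<not> (\<bar>cos p - cos (p + e / 2)\<bar> \<le> \<eta> \<and> \<bar>cos (p + e) - cos (p + e / 2)\<bar> \<le> \<eta>)" for p
  proof
    let ?m = "p + e / 2"
    assume *: "\<bar>cos p - cos ?m\<bar> \<le> \<eta> \<and> \<bar>cos (p + e) - cos ?m\<bar> \<le> \<eta>"
    have p: "cos p = cos ?m * (1 - A) + sin ?m * B"
      using cos_diff [of ?m "e / 2"] by (simp add: A_def B_def)
    have q: "cos (p + e) = cos ?m * (1 - A) - sin ?m * B"
      using cos_add [of ?m "e / 2"] by (simp add: A_def B_def add.commute)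
    have "\<bar>cos ?m * A\<bar> \<le> \<eta>" using * p q by (simp add: algebra_simps abs_if split: if_splits)
    moreover have "\<bar>sin ?m * B\<bar> \<le> \<eta>" using * p q by (simp add: algebra_simps abs_if split: if_splits)
    ultimately have "\<bar>cos ?m\<bar> * A \<le> A / 2" "\<bar>sin ?m\<bar> * B \<le> B / 2"
      using A B by (auto simp: abs_mult \<eta>_def)
    hence "\<bar>cos ?m\<bar> \<le> 1 / 2" "\<bar>sin ?m\<bar> \<le> 1 / 2" using A B by (auto simp: field_simps)
    hence "\<bar>cos ?m\<bar>\<^sup>2 \<le> (1 / 2)\<^sup>2" "\<bar>sin ?m\<bar>\<^sup>2 \<le> (1 / 2)\<^sup>2" by (intro power_mono; simp)+
    hence "(cos ?m)\<^sup>2 \<le> (1 / 2)\<^sup>2" "(sin ?m)\<^sup>2 \<le> (1 / 2)\<^sup>2" by simp_all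
    thus False using sin_cos_squared_add [of ?m] by (simp add: power2_eq_square)
  qed
  thus thesis using that \<eta> by blast
qed

lemma Cauchy_limit_within:
  fixes f :: "'a::metric_space \<Rightarrow> 'b::complete_space"
  assumes "p \<in> closure U"
    and "\<And>e. e > 0 \<Longrightarrow> \<exists>d>0. \<forall>z\<in>U \<inter> ball p d. \<forall>z'\<in>U \<inter> ball p d. dist (f z) (f z') < e"
  shows "\<exists>L. (f \<longlongrightarrow> L) (at p within U)"
proof -
  obtain X where X: "\<And>k. X k \<in> U" "X \<longlonglongrightarrow> p" using assms(1) closure_sequential by metis
  have ev: "eventually (\<lambda>k. X k \<in> ball p d) sequentially" if "d > 0" for d
    using X(2) that by (auto simp: tendsto_iff dist_commute)
  have "Cauchy (\<lambda>k. f (X k))"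
  proof (rule metric_CauchyI)
    fix e :: real assume "e > 0"
    then obtain d where d: "d > 0" "\<forall>z\<in>U \<inter> ball p d. \<forall>z'\<in>U \<inter> ball p d. dist (f z) (f z') < e"
      using assms(2) by blast
    show "\<exists>M. \<forall>m\<ge>M. \<forall>n\<ge>M. dist (f (X m)) (f (X n)) < e"
      using ev [OF d(1)] d(2) X(1) unfolding eventually_sequentially by blast
  qed
  then obtain L where L: "(\<lambda>k. f (X k)) \<longlonglongrightarrow> L" using Cauchy_convergent convergent_def by blast
  have "(f \<longlongrightarrow> L) (at p within U)"
  proof (rule tendstoI)
    fix e :: real assume "e > 0"
    then obtain d where d: "d > 0" "\<forall>z\<in>U \<inter> ball p d. \<forall>z'\<in>U \<inter> ball p d. dist (f z) (f z') < e / 2"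
      using assms(2) [of "e / 2"] by auto
    have "eventually (\<lambda>k. dist (f (X k)) L < e / 2) sequentially"
      by (rule tendstoD [OF L]) (use \<open>e > 0\<close> in simp)
    then obtain k where k: "X k \<in> ball p d" "dist (f (X k)) L < e / 2"
      using eventually_happens [OF eventually_conj [OF ev [OF d(1)]]] by auto
    have "dist (f z) L < e" if "z \<in> U" "dist z p < d" for z
    proof -
      have "dist (f z) (f (X k)) < e / 2" using d(2) k X(1) [of k] that by (auto simp: dist_commute)
      thus ?thesis using k dist_triangle [of "f z" L "f (X k)"] by linarith
    qed
    thus "eventually (\<lambda>z. dist (f z) L < e) (at p within U)"
      unfolding eventually_at using d(1) by blast
  qed
  thus ?thesis by blast
qed

lemma continuous_on_limit_extension:
  fixes f g :: "'a::metric_space \<Rightarrow> 'b::metric_space"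
  assumes "\<And>p. p \<in> S \<Longrightarrow> (f \<longlongrightarrow> g p) (at p within U)" "U \<subseteq> S" "S \<subseteq> closure U" "open U"
    "\<And>p. p \<in> U \<Longrightarrow> g p = f p"
  shows "continuous_on S g"
  unfolding continuous_on_iff
proof (intro ballI allI impI)
  fix p and e :: real assume p: "p \<in> S" and "e > 0"
  have "eventually (\<lambda>z. dist (f z) (g p) < e / 2) (at p within U)"
    by (rule tendstoD [OF assms(1) [OF p]]) (use \<open>e > 0\<close> in simp)
  then obtain d where d: "d > 0" "\<And>z. z \<in> U \<Longrightarrow> z \<noteq> p \<Longrightarrow> dist z p < d \<Longrightarrow> dist (f z) (g p) < e / 2"
    unfolding eventually_at by blast
  have d': "dist (g z) (g p) < e / 2" if "z \<in> U" "dist z p < d" for z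
    using d(2) [of z] that assms(5) [of z] \<open>e > 0\<close> by (cases "z = p") auto
  show "\<exists>d>0. \<forall>q\<in>S. dist q p < d \<longrightarrow> dist (g q) (g p) < e"
  proof (intro exI conjI ballI impI)
    fix q assume q: "q \<in> S" "dist q p < d"
    show "dist (g q) (g p) < e"
    proof (cases "q \<in> U")
      case True thus ?thesis using d' q \<open>e > 0\<close> by fastforce
    next
      case False
      have nt: "at q within U \<noteq> bot" using q False assms(3) closure_def trivial_limit_within by (metis Un_iff mem_Collect_eq subsetD)
      \<comment> \<open>A non-strict bound passes to the limit at \<open>q\<close>; halving
        \<open>e\<close> restores strictness.\<close>
      have "eventually (\<lambda>z. dist (f z) (g p) \<le> e / 2) (at q within U)"
        unfolding eventually_at
      proof (intro exI [of _ "d - dist q p"] conjI ballI impI)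
        show "0 < d - dist q p" using q by simp
        fix z assume z: "z \<in> U" "z \<noteq> q \<and> dist z q < d - dist q p"
        hence "dist z p < d" using dist_triangle [of z p q] by linarith
        thus "dist (f z) (g p) \<le> e / 2" using d' [of z] z assms(5) [of z] by simp
      qed
      hence "dist (g q) (g p) \<le> e / 2"
        using tendsto_upperbound [OF tendsto_dist [OF assms(1) [OF q(1)] tendsto_const]] nt by blast
      thus ?thesis using \<open>e > 0\<close> by linarith
    qed
  qed (use d in auto)
qed

section \<open>Angles modulo a full turn\<close>

lemma cis_eq_iff_int: "cis a = cis b \<longleftrightarrow> (\<exists>k::int. a = b + 2 * pi * of_int k)"
proof -
  have "cis a = cis b \<longleftrightarrow> (\<exists>k::int. \<i> * of_real a = \<i> * of_real b + (of_int (2 * k) * pi) * \<i>)"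
    unfolding cis_conv_exp exp_eq ..
  also have "\<dots> \<longleftrightarrow> (\<exists>k::int. a = b + 2 * pi * of_int k)"
  proof (rule ex_cong1)
    fix k :: int
    have "\<i> * of_real a = \<i> * of_real b + (of_int (2 * k) * pi) * \<i> \<longleftrightarrow>
        \<i> * of_real a = \<i> * complex_of_real (b + 2 * pi * of_int k)"
      by (simp add: algebra_simps)
    also have "\<dots> \<longleftrightarrow> a = b + 2 * pi * of_int k"
      by (simp only: mult_cancel_left complex_i_not_zero of_real_eq_iff simp_thms)
    finally show "(\<i> * of_real a = \<i> * of_real b + (of_int (2 * k) * pi) * \<i>) = (a = b + 2 * pi * of_int k)" .
  qed
  finally show ?thesis .
qed

lemma shift_mod_2pi:
  obtains s' :: real and m :: int where "x \<le> s'" "s' < x + 2 * pi" "s = s' + 2 * pi * of_int m"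
proof -
  define m where "m = \<lfloor>(s - x) / (2 * pi)\<rfloor>"
  have "of_int m \<le> (s - x) / (2 * pi)" "(s - x) / (2 * pi) < of_int m + 1" unfolding m_def by linarith+
  hence "of_int m * (2 * pi) \<le> s - x" "s - x < (of_int m + 1) * (2 * pi)" by (simp_all add: field_simps)
  thus thesis using that [of "s - 2 * pi * of_int m" m] by (simp add: algebra_simps)
qed

lemma cis_inj_near: 
  assumes "cis a = cis b" "\<bar>a - b\<bar> < 2 * pi" shows "a = b"
proof -
  obtain k :: int where k: "a = b + 2 * pi * of_int k" using assms cis_eq_iff_int by blast
  hence "2 * pi * \<bar>of_int k\<bar> < 2 * pi * 1" using assms(2) by (simp add: abs_mult)
  hence "\<bar>k\<bar> < 1" by simp
  thus ?thesis using k by simp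
qed

subsection \<open>Alternating trigonometric polynomials\<close>

text \<open>The Chebyshev recursion for \<open>cos (N a)\<close>, with the denominators \<open>exp (i n N z / 2)\<close> cleared.\<close>

fun cheb_comp :: "nat \<Rightarrow> complex poly \<Rightarrow> nat \<Rightarrow> complex poly" where
  "cheb_comp n P 0 = 1"
| "cheb_comp n P (Suc 0) = P"
| "cheb_comp n P (Suc (Suc N)) = 2 * P * cheb_comp n P (Suc N) - monom 1 n * cheb_comp n P N"

lemma degree_cheb_comp:
  assumes "degree P \<le> n" shows "degree (cheb_comp n P N) \<le> n * N"
  using assms
proof (induction n P N rule: cheb_comp.induct)
  case (3 n P N)
  hence IH: "degree (cheb_comp n P (Suc N)) \<le> n * Suc N" "degree (cheb_comp n P N) \<le> n * N" "degree P \<le> n"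
    by blast+
  have "degree (2 * P * cheb_comp n P (Suc N)) \<le> n * Suc (Suc N)"
    using degree_mult_le [of "2 * P" "cheb_comp n P (Suc N)"] degree_mult_le [of 2 P] IH by simp
  moreover have "degree (monom 1 n * cheb_comp n P N) \<le> n * Suc (Suc N)"
    using degree_mult_le [of "monom 1 n" "cheb_comp n P N"] degree_monom_le [of "1::complex" n] IH by simp
  ultimately show ?case by (simp add: degree_diff_le del: mult_Suc_right)
qed auto

text \<open>Here \<open>a\<close> is any preimage of \<open>trig n P z\<close> under cosine, so the
  identity can be used at single points, before a holomorphic phase exists.\<close>

lemma poly_cheb_comp:
  assumes "cos a = trig n P z"
  shows "poly (cheb_comp n P N) (exp (\<i> * z)) = exp (\<i> * of_nat n * of_nat N * z / 2) * cos (of_nat N * a)"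
  using assms
proof (induction n P N rule: cheb_comp.induct)
  case (1 n P)
  then show ?case by simp
next
  case (2 n P)
  then show ?case by (simp add: poly_eq_trig [of P z n])
next
  case (3 n P N)
  define e where "e = exp (\<i> * of_nat n * z / 2)"
  have eN: "exp (\<i> * of_nat n * of_nat M * z / 2) = e ^ M" for M
    unfolding e_def exp_of_nat_mult [symmetric] by (rule arg_cong [of _ _ exp]) (simp add: field_simps)
  \<comment> \<open>This square is the factor \<open>monom 1 n\<close> of the recursion; it lifts
    \<open>e ^ N\<close> to the power N + 2.\<close>
  have e2: "exp (\<i> * z) ^ n = e\<^sup>2"
    unfolding e_def exp_of_nat_mult [symmetric] by (rule arg_cong [of _ _ exp]) (simp add: field_simps)
  have P: "poly P (exp (\<i> * z)) = e * cos a" using 3 by (simp add: poly_eq_trig [of P z n] e_def)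
  have "cos (of_nat (Suc (Suc N)) * a) + cos (of_nat N * a) = 2 * cos a * cos (of_nat (Suc N) * a)"
    using cos_add [of "of_nat (Suc N) * a" a] cos_diff [of "of_nat (Suc N) * a" a] by (simp add: algebra_simps)
  hence c: "cos (of_nat (Suc (Suc N)) * a) = 2 * cos a * cos (of_nat (Suc N) * a) - cos (of_nat N * a)"
    by (simp add: algebra_simps)
  have IH: "poly (cheb_comp n P (Suc N)) (exp (\<i> * z)) = e ^ Suc N * cos (of_nat (Suc N) * a)"
    "poly (cheb_comp n P N) (exp (\<i> * z)) = e ^ N * cos (of_nat N * a)"
    using 3 unfolding eN by blast+
  show ?case
    unfolding eN c cheb_comp.simps poly_diff poly_mult IH P poly_monom e2
    by (simp add: power2_eq_square algebra_simps del: of_nat_Suc)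
qed

section \<open>The upper half-plane and alternation over one period\<close>

lemma open_UHP: "open upper_half_plane"
  by (simp add: upper_half_plane_def open_halfspace_Im_gt)

lemma convex_UHP: "convex upper_half_plane"
  by (simp add: upper_half_plane_def convex_halfspace_Im_gt)

lemma closure_UHP: "closure upper_half_plane = {z. Im z \<ge> 0}"
proof -
  have "closure {z. \<i> \<bullet> z > 0} = {z. \<i> \<bullet> z \<ge> 0}" by (rule closure_halfspace_gt) simp
  thus ?thesis by (simp add: upper_half_plane_def inner_complex_def)
qed

lemma norm_exp_UHP: "z \<in> upper_half_plane \<Longrightarrow> norm (exp (\<i> * z)) < 1"
  by (simp add: upper_half_plane_def)

locale alternating_poly =
  fixes n :: nat and P :: "complex poly" and t :: "nat \<Rightarrow> real"
  assumes n_pos: "n \<ge> 1" and deg: "degree P \<le> n"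
    and real_on_reals: "\<And>s::real. trig n P (of_real s) \<in> \<real>"
    and t_mono: "\<And>j. j < n \<Longrightarrow> t j < t (Suc j)"
    and t_period: "t n = t 0 + 2 * pi"
    and alternates: "\<And>j. j \<le> n \<Longrightarrow> trig n P (of_real (t j)) = (-1) ^ j"
begin

abbreviation T :: "complex \<Rightarrow> complex" where "T \<equiv> trig n P"

lemma t_le: "i \<le> j \<Longrightarrow> j \<le> n \<Longrightarrow> t i \<le> t j"
proof (induction j)
  case (Suc j) thus ?case using t_mono [of j] by (cases "i = Suc j") force+
qed auto

lemma T_value_between:
  assumes "j < n" "\<bar>c\<bar> < 1"
  shows "\<exists>s. t j < s \<and> s < t (Suc j) \<and> T (of_real s) = of_real c"
proof -
  define g where "g s = Re (T (of_real s))" for s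
  have g: "T (of_real s) = of_real (g s)" for s
    using real_on_reals [of s] by (simp add: g_def)
  have cont: "continuous_on {t j..t (Suc j)} g"
    unfolding g_def by (intro continuous_intros continuous_on_compose2 [OF trig_continuous [of UNIV]]) auto
  have gt: "g (t j) = (-1) ^ j" "g (t (Suc j)) = - ((-1) ^ j)"
    using alternates [of j] alternates [of "Suc j"] assms unfolding g_def by (cases "even j"; simp)+
  have le: "t j \<le> t (Suc j)" using t_mono assms by force
  have "\<exists>s. t j \<le> s \<and> s \<le> t (Suc j) \<and> g s = c"
  proof (cases "even j")
    case True thus ?thesis using IVT2' [of g "t (Suc j)" c "t j"] cont le gt assms by auto
  next
    case False thus ?thesis using IVT' [of g "t j" c "t (Suc j)"] cont le gt assms by auto
  qed
  then obtain s where s: "t j \<le> s" "s \<le> t (Suc j)" "g s = c" by blast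
  moreover have "s \<noteq> t j" "s \<noteq> t (Suc j)" using s gt assms by (cases "even j"; force)+
  ultimately show ?thesis using g by (metis order_le_less)
qed

text \<open>In each of the \<open>n\<close> gaps T takes all \<open>N\<close> values
  \<open>cos (\<phi> l)\<close>. This gives \<open>n * N\<close> distinct roots on the circle, and
  the degree bound leaves no room for others.\<close>

lemma cheb_roots:
  assumes "N \<ge> 1"
  shows "cheb_comp n P N \<noteq> 0" "degree (cheb_comp n P N) = n * N"
    "poly (cheb_comp n P N) w = 0 \<Longrightarrow> norm w = 1"
proof -
  let ?Q = "cheb_comp n P N"
  \<comment> \<open>The zeros of \<open>cos (N * _)\<close> in the interval from 0 to pi.\<close>
  define \<phi> where "\<phi> l = (2 * real l + 1) * pi / (2 * real N)" for l
  have \<phi>: "0 < \<phi> l" "\<phi> l < pi" if "l < N" for l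
  proof -
    show "0 < \<phi> l" using assms by (auto simp: \<phi>_def intro!: divide_pos_pos mult_pos_pos)
    have "2 * real l + 1 < 2 * real N" using that by linarith
    hence "(2 * real l + 1) * pi < (2 * real N) * pi" by simp
    thus "\<phi> l < pi" using assms by (simp add: \<phi>_def field_simps)
  qed
  have "\<exists>s. t j < s \<and> s < t (Suc j) \<and> T (of_real s) = of_real (cos (\<phi> l))" if "j < n" "l < N" for j l
  proof (rule T_value_between [OF that(1)])
    have "cos (\<phi> l) < cos 0" using \<phi> [OF that(2)] by (intro cos_monotone_0_pi) auto
    moreover have "cos pi < cos (\<phi> l)" using \<phi> [OF that(2)] by (intro cos_monotone_0_pi) auto
    ultimately show "\<bar>cos (\<phi> l)\<bar> < 1" by (simp add: abs_if)
  qed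
  then obtain s where s: "\<And>j l. j < n \<Longrightarrow> l < N \<Longrightarrow> t j < s j l \<and> s j l < t (Suc j) \<and> T (of_real (s j l)) = of_real (cos (\<phi> l))"
    by metis
  define R where "R = (\<lambda>(j, l). cis (s j l)) ` ({..<n} \<times> {..<N})"
  have inj: "inj_on (\<lambda>(j, l). cis (s j l)) ({..<n} \<times> {..<N})"
  proof (rule inj_onI, clarsimp)
    fix j l j' l' assume *: "j < n" "l < N" "j' < n" "l' < N" "cis (s j l) = cis (s j' l')"
    have b: "t 0 < s i m \<and> s i m < t 0 + 2 * pi" if "i < n" "m < N" for i m
      using s [OF that] t_le [of 0 i] t_le [of "Suc i" n] that t_period by fastforce
    have eq: "s j l = s j' l'" using *(5) by (rule cis_inj_near) (use b[of j l] b[of j' l'] * in linarith)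
    have "\<not> j < j'" using eq s [of j l] s [of j' l'] * t_le [of "Suc j" j'] by force
    moreover have "\<not> j' < j" using eq s [of j l] s [of j' l'] * t_le [of "Suc j'" j] by force
    ultimately have j: "j = j'" by simp
    have "cos (\<phi> l) = cos (\<phi> l')" using s [of j l] s [of j' l'] * eq by (metis of_real_eq_iff)
    hence "\<phi> l = \<phi> l'" using \<phi> [of l] \<phi> [of l'] * by (metis arccos_cos less_imp_le)
    hence "l = l'" using assms by (simp add: \<phi>_def field_simps)
    thus "j = j' \<and> l = l'" using j by simp
  qed
  have cR: "card R = n * N" unfolding R_def using inj by (simp add: card_image card_cartesian_product)
  have RQ: "R \<subseteq> {w. poly ?Q w = 0}"
  proof
    fix w assume "w \<in> R"
    then obtain j l where jl: "j < n" "l < N" "w = cis (s j l)" by (auto simp: R_def)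
    have "cos (complex_of_real (\<phi> l)) = T (of_real (s j l))" using s [OF jl(1,2)] by (simp add: cos_of_real)
    from poly_cheb_comp [OF this, of N] have "poly ?Q w = 
        exp (\<i> * of_nat n * of_nat N * of_real (s j l) / 2) * cos (of_nat N * complex_of_real (\<phi> l))"
      by (simp add: jl cis_conv_exp)
    moreover have "cos (of_nat N * complex_of_real (\<phi> l)) = 0"
    proof -
      have "real N * \<phi> l = real l * pi + pi / 2" using assms by (simp add: \<phi>_def field_simps)
      hence "cos (real N * \<phi> l) = 0" by (simp add: cos_add)
      thus ?thesis by (metis cos_of_real of_real_0 of_real_mult of_real_of_nat_eq)
    qed
    ultimately show "w \<in> {w. poly ?Q w = 0}" by simp
  qed
  have "cos 0 = T (of_real (t 0))" using alternates [of 0] by simp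
  from poly_cheb_comp [OF this, of N] have "poly ?Q (exp (\<i> * of_real (t 0))) \<noteq> 0" by simp
  thus ne: "?Q \<noteq> 0" by auto
  show "degree ?Q = n * N"
    by (rule roots_eq_of_card(1) [OF ne degree_cheb_comp [OF deg] RQ]) (simp add: cR)
  have "{w. poly ?Q w = 0} = R"
    by (rule roots_eq_of_card(2) [OF ne degree_cheb_comp [OF deg] RQ]) (simp add: cR)
  moreover have "norm w = 1" if "w \<in> R" using that by (auto simp: R_def)
  ultimately show "norm w = 1" if "poly ?Q w = 0" using that by blast
qed

lemma T_not_constant: "\<not> T constant_on UNIV"
proof
  assume "T constant_on UNIV"
  hence "T (of_real (t 0)) = T (of_real (t 1))" by (auto simp: constant_on_def)
  thus False using alternates [of 0] alternates [of 1] n_pos by simp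
qed


text \<open>The values \<open>cos \<psi>\<close> with \<open>cos (N * \<psi>) = 0\<close> become
  dense in [-1, 1] as \<open>N\<close> grows. T is open, so near a forbidden value it would also
  take such a value in the half-plane, and \<open>cheb_comp n P N\<close> would have a root inside
  the unit disc.\<close>

lemma T_UHP_not_unit_interval:
  assumes "z \<in> upper_half_plane" "c \<in> {-1..1}" 
  shows "T z \<noteq> of_real c"
proof
  assume Tz: "T z = of_real c"
  have "open (T ` upper_half_plane)"
    by (rule open_mapping_thm [OF trig_holomorphic open_UNIV connected_UNIV open_UHP _ T_not_constant]) simp
  then obtain e where e: "e > 0" "ball (of_real c) e \<subseteq> T ` upper_half_plane"
    using assms(1) Tz by (metis image_eqI open_contains_ball)
  define \<phi> where "\<phi> = arccos c"
  have \<phi>: "cos \<phi> = c" "0 \<le> \<phi>" using assms(2) by (auto simp: \<phi>_def arccos_lbound)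
  \<comment> \<open>The centre of the cell of length \<open>pi / N\<close> that contains
    \<open>\<phi>\<close>, hence an odd multiple of \<open>pi / (2 * N)\<close>.\<close>
  define \<psi> where "\<psi> N = (2 * of_int \<lfloor>real N * \<phi> / pi\<rfloor> + 1) * pi / (2 * real N)" for N
  have close: "\<bar>\<psi> N - \<phi>\<bar> \<le> pi / (2 * real N)" if "N \<ge> 1" for N
  proof -
    define k where "k = real_of_int \<lfloor>real N * \<phi> / pi\<rfloor>"
    have "k \<le> real N * \<phi> / pi" "real N * \<phi> / pi < k + 1" unfolding k_def by linarith+
    hence k: "k * pi \<le> real N * \<phi>" "real N * \<phi> \<le> (k + 1) * pi" by (simp_all add: field_simps)
    have eq: "\<psi> N - \<phi> = ((2 * k + 1) * pi - 2 * (real N * \<phi>)) / (2 * real N)"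
      using that by (simp add: \<psi>_def k_def field_simps)
    have "\<bar>(2 * k + 1) * pi - 2 * (real N * \<phi>)\<bar> \<le> pi" using k by (simp add: algebra_simps abs_le_iff)
    thus ?thesis unfolding eq using that by (simp add: abs_divide divide_right_mono)
  qed
  have "(\<lambda>N. pi / (2 * real N)) \<longlonglongrightarrow> 0" using lim_const_over_n [of "pi / 2"] by simp
  hence "(\<lambda>N. \<psi> N - \<phi>) \<longlonglongrightarrow> 0"
    by (rule Lim_null_comparison [rotated]) (use close in \<open>auto simp: eventually_sequentially\<close>)
  hence "\<psi> \<longlonglongrightarrow> \<phi>" by (simp add: LIM_zero_iff)
  hence "(\<lambda>N. complex_of_real (cos (\<psi> N))) \<longlonglongrightarrow> of_real (cos \<phi>)" by (intro tendsto_intros)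
  hence "eventually (\<lambda>N. dist (complex_of_real (cos (\<psi> N))) (of_real c) < e) sequentially"
    using e(1) \<phi> tendstoD by fastforce
  then obtain N where N: "N \<ge> 1" "dist (complex_of_real (cos (\<psi> N))) (of_real c) < e"
    using eventually_happens [OF eventually_conj [OF _ eventually_ge_at_top [of 1]]] trivial_limit_sequentially by blast
  hence "complex_of_real (cos (\<psi> N)) \<in> T ` upper_half_plane" using e(2) by (auto simp: dist_commute)
  then obtain y where y: "y \<in> upper_half_plane" "cos (complex_of_real (\<psi> N)) = T y" by (auto simp: cos_of_real)
  define k where "k = \<lfloor>real N * \<phi> / pi\<rfloor>"
  have "real N * \<psi> N = of_int k * pi + pi / 2" using N by (simp add: \<psi>_def k_def field_simps)
  hence "cos (real N * \<psi> N) = 0" by (simp add: cos_add sin_integer_2pi sin_zero_iff_int2)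
  hence "cos (of_nat N * complex_of_real (\<psi> N)) = 0"
    by (metis cos_of_real of_real_0 of_real_mult of_real_of_nat_eq)
  hence "poly (cheb_comp n P N) (exp (\<i> * y)) = 0" using poly_cheb_comp [OF y(2), of N] by simp
  hence "norm (exp (\<i> * y)) = 1" using cheb_roots(3) [OF N(1)] by blast
  thus False using norm_exp_UHP [OF y(1)] by simp
qed

text \<open>T omits 1 and -1, so it has a holomorphic arc cosine on the contractible half-plane.
  This is never real, as real numbers have cosine in [-1, 1]; its imaginary part thus has one sign,
  which evenness of cosine makes positive.\<close>

lemma theta_exists:
  obtains \<theta> where "\<theta> holomorphic_on upper_half_plane" 
    "\<And>z. z \<in> upper_half_plane \<Longrightarrow> cos (\<theta> z) = T z"
    "\<And>z. z \<in> upper_half_plane \<Longrightarrow> Im (\<theta> z) > 0"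
proof -
  have pm: "T z \<noteq> 1 \<and> T z \<noteq> -1" if "z \<in> upper_half_plane" for z
    using T_UHP_not_unit_interval [OF that, of 1] T_UHP_not_unit_interval [OF that, of "-1"] by simp
  obtain g where g: "g holomorphic_on upper_half_plane" "\<And>z. z \<in> upper_half_plane \<Longrightarrow> T z = cos (g z)"
    using contractible_imp_holomorphic_arccos [OF trig_holomorphic convex_imp_contractible [OF convex_UHP] pm] by blast
  have ne: "Im (g z) \<noteq> 0" if "z \<in> upper_half_plane" for z
  proof
    assume "Im (g z) = 0"
    hence "g z = of_real (Re (g z))" by (simp add: complex_eq_iff)
    hence "T z = of_real (cos (Re (g z)))" using g(2) [OF that] by (metis cos_of_real)
    thus False using T_UHP_not_unit_interval [OF that, of "cos (Re (g z))"] by simp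
  qed
  have conn: "connected ((\<lambda>z. Im (g z)) ` upper_half_plane)"
    by (intro connected_continuous_image continuous_intros holomorphic_on_imp_continuous_on g convex_connected convex_UHP)
  have i: "\<i> \<in> upper_half_plane" by (simp add: upper_half_plane_def)
  show thesis
  proof (cases "Im (g \<i>) > 0")
    case True
    have "Im (g z) > 0" if z: "z \<in> upper_half_plane" for z
    proof (rule ccontr)
      assume "\<not> Im (g z) > 0"
      hence "0 \<in> (\<lambda>z. Im (g z)) ` upper_half_plane"
        using connectedD_interval [OF conn, of "Im (g z)" "Im (g \<i>)" 0] True z i by force
      thus False using ne by force
    qed
    thus thesis using that g by simp
  next
    case False
    have "Im (g z) < 0" if z: "z \<in> upper_half_plane" for z
    proof (rule ccontr)
      assume "\<not> Im (g z) < 0"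
      hence "0 \<in> (\<lambda>z. Im (g z)) ` upper_half_plane"
        using connectedD_interval [OF conn, of "Im (g \<i>)" "Im (g z)" 0] False z i by force
      thus False using ne by force
    qed
    thus thesis using that [of "\<lambda>z. - g z"] g by (auto intro!: holomorphic_intros)
  qed
qed

end

text \<open>Since \<open>cosh\<close> is flat at 0, its differences control those of the argument
  only quadratically, which suffices for a Cauchy criterion.\<close>

lemma cosh_diff_ge:
  fixes a b :: real
  assumes "0 \<le> a" "a \<le> b"
  shows "cosh b - cosh a \<ge> (b - a)\<^sup>2 / 2"
proof -
  have s: "sinh x \<ge> x" if "x \<ge> 0" for x :: real
    using real_le_x_sinh [OF that] by (simp add: sinh_def exp_minus)
  have "cosh b - cosh a = 2 * sinh ((a + b) / 2) * sinh ((b - a) / 2)"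
    using cosh_add [of "(a + b) / 2" "(b - a) / 2"] cosh_diff [of "(a + b) / 2" "(b - a) / 2"]
    by (simp add: field_simps)
  moreover have "sinh ((a + b) / 2) \<ge> (b - a) / 2" "sinh ((b - a) / 2) \<ge> (b - a) / 2"
  proof -
    have "0 \<le> (a + b) / 2" "0 \<le> (b - a) / 2" "(b - a) / 2 \<le> (a + b) / 2" using assms by auto
    thus "sinh ((a + b) / 2) \<ge> (b - a) / 2" "sinh ((b - a) / 2) \<ge> (b - a) / 2"
      using s [of "(a + b) / 2"] s [of "(b - a) / 2"] by linarith+
  qed
  moreover have "((b - a) / 2) * ((b - a) / 2) \<le> sinh ((a + b) / 2) * sinh ((b - a) / 2)"
    using calculation assms by (intro mult_mono) auto
  ultimately show ?thesis by (simp add: power2_eq_square algebra_simps)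
qed

text \<open>In this form the tangent depends on \<open>exp (2 * \<i> * u)\<close> alone, which
  decays as \<open>Im u\<close> grows, so the limit \<open>\<i>\<close> is visible.\<close>

lemma sin_over_cos_exp:
  fixes u :: complex
  assumes "cos u \<noteq> 0"
  shows "sin u / cos u = \<i> * (1 - exp (2 * \<i> * u)) / (1 + exp (2 * \<i> * u))"
proof -
  define E where "E = exp (\<i> * u)"
  have E0: "E \<noteq> 0" by (simp add: E_def)
  have s: "sin u = (E - 1 / E) / (2 * \<i>)" and c: "cos u = (E + 1 / E) / 2"
    by (simp_all add: sin_exp_eq cos_exp_eq E_def exp_minus inverse_eq_divide)
  have E2: "exp (2 * \<i> * u) = E * E" by (simp add: E_def mult.assoc flip: exp_add)
  have ne: "1 + E * E \<noteq> 0" using assms E0 unfolding c by (simp add: field_simps)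
  have "sin u = (E * E - 1) / (2 * \<i> * E)" "cos u = (E * E + 1) / (2 * E)"
    unfolding s c using E0 by (simp_all add: field_simps)
  hence "sin u / cos u = (E * E - 1) / (2 * \<i> * E) / ((E * E + 1) / (2 * E))" by simp
  also have "\<dots> = (E * E - 1) / (\<i> * (E * E + 1))"
    using E0 ne by (simp add: divide_simps) (simp add: algebra_simps)
  also have "\<dots> = \<i> * (1 - E * E) / (1 + E * E)" using ne by (simp add: divide_simps) (simp add: algebra_simps)
  finally show ?thesis by (simp add: E2)
qed

section \<open>Derivative and boundary limits of the phase\<close>

context alternating_poly
begin

text \<open>The logarithmic derivative of \<open>cos (N * \<theta>)\<close> is computed twice, from
  the phase and from \<open>cheb_comp n P N\<close>. Both results scale with \<open>N\<close>;
  dividing by it leaves a bound independent of \<open>N\<close>.\<close>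

lemma Re_deriv_ge:
  assumes hol: "\<theta> holomorphic_on upper_half_plane" 
    and cosT: "\<And>z. z \<in> upper_half_plane \<Longrightarrow> cos (\<theta> z) = T z"
    and Imp: "\<And>z. z \<in> upper_half_plane \<Longrightarrow> Im (\<theta> z) > 0"
    and z: "z \<in> upper_half_plane"
  shows "Re (deriv \<theta> z) \<ge> n * (1 - (norm (exp (\<i> * z)))\<^sup>2) / 8"
proof -
  define w where "w = exp (\<i> * z)"
  define q where "q = exp (2 * \<i> * \<theta> z)"
  have w: "norm w < 1" using norm_exp_UHP z by (simp add: w_def)
  have q: "norm q < 1" using Imp [OF z] by (simp add: q_def)
  have der: "(\<theta> has_field_derivative deriv \<theta> z) (at z)"
    using hol z open_UHP holomorphic_derivI by blast
  have bound: "Im (\<i> * (1 - q ^ N) / (1 + q ^ N) * deriv \<theta> z) \<ge> n * (1 - (norm w)\<^sup>2) / 8" if N: "N \<ge> 1" for N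
  proof -
    let ?Q = "cheb_comp n P N"
    define e where "e = exp (- (\<i> * of_nat n * of_nat N * z / 2))"
    have F: "cos (of_nat N * \<theta> y) = exp (- (\<i> * of_nat n * of_nat N * y / 2)) * poly ?Q (exp (\<i> * y))"
      if "y \<in> upper_half_plane" for y
      unfolding poly_cheb_comp [OF cosT [OF that], of N] by (simp add: exp_minus field_simps)
    have "((\<lambda>y. cos (of_nat N * \<theta> y)) has_field_derivative - sin (of_nat N * \<theta> z) * (of_nat N * deriv \<theta> z)) (at z)"
      by (auto intro!: derivative_eq_intros der)
    moreover have "((\<lambda>y. exp (- (\<i> * of_nat n * of_nat N * y / 2)) * poly ?Q (exp (\<i> * y))) has_field_derivative
        e * (- (\<i> * of_nat n * of_nat N / 2)) * poly ?Q w + e * (poly (pderiv ?Q) w * (w * \<i>))) (at z)"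
      unfolding e_def w_def
      by (rule derivative_eq_intros DERIV_chain2 [OF poly_DERIV] refl | simp)+
    hence "((\<lambda>y. cos (of_nat N * \<theta> y)) has_field_derivative
        e * (- (\<i> * of_nat n * of_nat N / 2)) * poly ?Q w + e * (poly (pderiv ?Q) w * (w * \<i>))) (at z)"
      by (rule has_field_derivative_transform_within_open [OF _ open_UHP z]) (use F in simp)
    ultimately have eq: "- sin (of_nat N * \<theta> z) * (of_nat N * deriv \<theta> z) =
        e * (- (\<i> * of_nat n * of_nat N / 2)) * poly ?Q w + e * (poly (pderiv ?Q) w * (w * \<i>))"
      by (rule DERIV_unique)
    have Fz: "cos (of_nat N * \<theta> z) = e * poly ?Q w" using F [OF z] by (simp add: e_def w_def)
    have Q0: "poly ?Q w \<noteq> 0" using cheb_roots(3) [OF N] w by fastforce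
    have e0: "e \<noteq> 0" by (simp add: e_def)
    have c0: "cos (of_nat N * \<theta> z) \<noteq> 0" using Fz Q0 e0 by simp
    have "- (sin (of_nat N * \<theta> z) / cos (of_nat N * \<theta> z)) * (of_nat N * deriv \<theta> z)
      = - (\<i> * of_nat n * of_nat N / 2) + \<i> * (w * poly (pderiv ?Q) w / poly ?Q w)"
    proof -
      have "- (sin (of_nat N * \<theta> z) / cos (of_nat N * \<theta> z)) * (of_nat N * deriv \<theta> z)
        = (- sin (of_nat N * \<theta> z) * (of_nat N * deriv \<theta> z)) / (e * poly ?Q w)"
        by (simp add: Fz)
      also have "\<dots> = - (\<i> * of_nat n * of_nat N / 2) + \<i> * (w * poly (pderiv ?Q) w / poly ?Q w)"
        unfolding eq using e0 Q0 by (simp add: field_simps)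
      finally show ?thesis .
    qed
    moreover have "sin (of_nat N * \<theta> z) / cos (of_nat N * \<theta> z) = \<i> * (1 - q ^ N) / (1 + q ^ N)"
      unfolding sin_over_cos_exp [OF c0] q_def exp_of_nat_mult [symmetric] by (simp add: algebra_simps)
    ultimately have "of_nat N * (\<i> * (1 - q ^ N) / (1 + q ^ N) * deriv \<theta> z)
       = \<i> * of_nat n * of_nat N / 2 - \<i> * (w * poly (pderiv ?Q) w / poly ?Q w)"
      by (simp add: algebra_simps)
    hence *: "Im (of_nat N * (\<i> * (1 - q ^ N) / (1 + q ^ N) * deriv \<theta> z))
       = Im (\<i> * of_nat n * of_nat N / 2 - \<i> * (w * poly (pderiv ?Q) w / poly ?Q w))" by simp
    have "N * Im (\<i> * (1 - q ^ N) / (1 + q ^ N) * deriv \<theta> z)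
       = n * N / 2 - Re (w * poly (pderiv ?Q) w / poly ?Q w)" 
    proof -
      have NIm: "N * Im u = Im (of_nat N * u)" for u by simp
      have "Im (\<i> * of_nat n * of_nat N / 2 - \<i> * v) = n * N / 2 - Re v" for v by simp
      thus ?thesis unfolding NIm * by blast
    qed
    also have "\<dots> \<ge> n * N / 2 - degree ?Q * (1 / 2 - (1 - (norm w)\<^sup>2) / 8)"
      using Re_log_deriv_poly_circle [OF cheb_roots(1) [OF N] cheb_roots(3) [OF N] w] by simp
    \<comment> \<open>The contribution \<open>n * N / 2\<close> of the exponential cancels the 1/2
      of each root, and only the gaps remain.\<close>
    also have "n * N / 2 - degree ?Q * (1 / 2 - (1 - (norm w)\<^sup>2) / 8) = N * (n * (1 - (norm w)\<^sup>2) / 8)"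
      unfolding cheb_roots(2) [OF N] by (simp add: algebra_simps)
    finally show ?thesis using N by (simp only: mult_le_cancel_left)
  qed
  \<comment> \<open>As |q| < 1, the factor of \<open>deriv \<theta> z\<close> tends to
    \<open>\<i>\<close>, which turns the imaginary part into the real part of the
    derivative.\<close>
  have qN: "(\<lambda>N. q ^ N) \<longlonglongrightarrow> 0" using q by (rule LIMSEQ_power_zero)
  have "(\<lambda>N. Im (\<i> * (1 - q ^ N) / (1 + q ^ N) * deriv \<theta> z)) \<longlonglongrightarrow> Im (\<i> * (1 - 0) / (1 + 0) * deriv \<theta> z)"
    by (intro tendsto_intros qN) auto
  hence "Im (\<i> * (1 - 0) / (1 + 0) * deriv \<theta> z) \<ge> n * (1 - (norm w)\<^sup>2) / 8"
    by (rule LIMSEQ_le_const) (use bound in blast)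
  thus ?thesis by (simp add: w_def)
qed

lemma Re_quotient_UHP:
  assumes hol: "\<theta> holomorphic_on upper_half_plane" 
    and cosT: "\<And>z. z \<in> upper_half_plane \<Longrightarrow> cos (\<theta> z) = T z"
    and Imp: "\<And>z. z \<in> upper_half_plane \<Longrightarrow> Im (\<theta> z) > 0"
    and ab: "y > 0" "Im a \<ge> y" "Im b \<ge> y" "a \<noteq> b"
  shows "Re ((\<theta> b - \<theta> a) / (b - a)) \<ge> n * (1 - exp (- 2 * y)) / 8"
proof (rule Re_quotient_ge [OF hol open_UHP _ ab(4)])
  have seg: "closed_segment a b \<subseteq> {z. Im z \<ge> y}"
    using ab by (intro closed_segment_subset convex_halfspace_Im_ge) auto
  thus "closed_segment a b \<subseteq> upper_half_plane" using ab(1) by (auto simp: upper_half_plane_def)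
  fix z assume "z \<in> closed_segment a b"
  hence z: "Im z \<ge> y" using seg by auto
  have "(norm (exp (\<i> * z)))\<^sup>2 = exp (- 2 * Im z)" by (simp add: flip: exp_double)
  also have "\<dots> \<le> exp (- 2 * y)" using z by simp
  finally have "n * (1 - exp (- 2 * y)) / 8 \<le> n * (1 - (norm (exp (\<i> * z)))\<^sup>2) / 8"
    by (intro divide_right_mono mult_left_mono) auto
  also have "\<dots> \<le> Re (deriv \<theta> z)"
    by (rule Re_deriv_ge [OF hol cosT Imp]) (use z ab in \<open>auto simp: upper_half_plane_def\<close>)
  finally show "n * (1 - exp (- 2 * y)) / 8 \<le> Re (deriv \<theta> z)" .
qed

lemma boundary_limit:
  assumes hol: "\<theta> holomorphic_on upper_half_plane" 
    and cosT: "\<And>z. z \<in> upper_half_plane \<Longrightarrow> cos (\<theta> z) = T z"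
    and Imp: "\<And>z. z \<in> upper_half_plane \<Longrightarrow> Im (\<theta> z) > 0"
    and p: "Im p = 0"
  shows "\<exists>L. (\<theta> \<longlongrightarrow> L) (at p within upper_half_plane)"
proof -
  text \<open>\<open>T \<plusminus> 1\<close> determines \<open>cos (Re \<theta>)\<close> and \<open>cosh (Im \<theta>)\<close>, which hence extend continuously; connectedness
    of half-discs excludes jumps of \<open>Re \<theta>\<close>.\<close>
  define C where "C z = (norm (T z + 1) - norm (T z - 1)) / 2" for z
  define D where "D z = (norm (T z + 1) + norm (T z - 1)) / 2" for z
  have C: "cos (Re (\<theta> z)) = C z" and D: "cosh (Im (\<theta> z)) = D z" if "z \<in> upper_half_plane" for z
    using cmod_cos_pm1 [of "\<theta> z"] cosT [OF that] by (simp_all add: C_def D_def)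
  have cont: "continuous_on UNIV C" "continuous_on UNIV D"
    unfolding C_def D_def by (intro continuous_intros trig_continuous; simp)+
  have conv: "convex (upper_half_plane \<inter> ball p d)" for d by (intro convex_Int convex_UHP convex_ball)
  have near: "\<exists>d>0. \<forall>z\<in>ball p d. \<bar>f z - f p\<bar> < e" if f: "continuous_on UNIV f" "e > 0" for f :: "complex \<Rightarrow> real" and e
  proof -
    obtain d where "d > 0" "\<And>z. dist z p < d \<Longrightarrow> dist (f z) (f p) < e"
      using f unfolding continuous_on_iff by (meson UNIV_I)
    thus ?thesis by (intro exI [of _ d]) (simp add: dist_commute [of p] dist_real_def)
  qed
  have pcl: "p \<in> closure upper_half_plane" unfolding closure_UHP using p by simp
  have "\<exists>L. ((\<lambda>z. Re (\<theta> z)) \<longlongrightarrow> L) (at p within upper_half_plane)"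
  proof (rule Cauchy_limit_within [OF pcl])
    fix e0 :: real assume "e0 > 0"
    define e where "e = min e0 1"
    have e: "0 < e" "e \<le> 1" "e \<le> e0" using \<open>e0 > 0\<close> by (auto simp: e_def)
    obtain \<eta> where \<eta>: "\<eta> > 0" "\<And>r. \<not> (\<bar>cos r - cos (r + e / 2)\<bar> \<le> \<eta> \<and> \<bar>cos (r + e) - cos (r + e / 2)\<bar> \<le> \<eta>)"
      using cos_oscillation [OF e(1,2)] by blast
    obtain d where d: "d > 0" "\<And>z. z \<in> ball p d \<Longrightarrow> \<bar>C z - C p\<bar> < \<eta> / 2"
      using near [OF cont(1), of "\<eta> / 2"] \<eta>(1) by auto
    let ?B = "upper_half_plane \<inter> ball p d"
    have conn: "connected ((\<lambda>z. Re (\<theta> z)) ` ?B)"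
      by (intro connected_continuous_image continuous_intros convex_connected conv
          continuous_on_subset [OF holomorphic_on_imp_continuous_on [OF hol]]) auto
    have close: "\<bar>cos r - C p\<bar> < \<eta> / 2" if "r \<in> (\<lambda>z. Re (\<theta> z)) ` ?B" for r
      using that d(2) C by auto
    \<comment> \<open>A move by \<open>e\<close> would put three equally spaced points into the
      connected image, although cosine is nearly constant on it.\<close>
    have key: "Re (\<theta> z') < Re (\<theta> z) + e" if "z \<in> ?B" "z' \<in> ?B" for z z'
    proof (rule ccontr)
      assume "\<not> Re (\<theta> z') < Re (\<theta> z) + e"
      hence le: "Re (\<theta> z) + e \<le> Re (\<theta> z')" by simp
      have "r \<in> (\<lambda>z. Re (\<theta> z)) ` ?B" if "Re (\<theta> z) \<le> r" "r \<le> Re (\<theta> z) + e" for r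
        using connectedD_interval [OF conn, of "Re (\<theta> z)" "Re (\<theta> z')" r] \<open>z \<in> ?B\<close> \<open>z' \<in> ?B\<close> that le by auto
      hence *: "\<bar>cos r - C p\<bar> < \<eta> / 2" if "Re (\<theta> z) \<le> r" "r \<le> Re (\<theta> z) + e" for r
        using close that by blast
      show False
        using \<eta>(2) [of "Re (\<theta> z)"] * [of "Re (\<theta> z)"] * [of "Re (\<theta> z) + e / 2"] * [of "Re (\<theta> z) + e"] e by (simp add: abs_if split: if_splits)
    qed
    show "\<exists>d>0. \<forall>z\<in>upper_half_plane \<inter> ball p d. \<forall>z'\<in>upper_half_plane \<inter> ball p d. dist (Re (\<theta> z)) (Re (\<theta> z')) < e0"
    proof (intro exI conjI ballI)
      fix z z' assume "z \<in> ?B" "z' \<in> ?B"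
      thus "dist (Re (\<theta> z)) (Re (\<theta> z')) < e0" using key [of z z'] key [of z' z] e by (auto simp: dist_real_def abs_if)
    qed (use d in auto)
  qed
  then obtain L1 where L1: "((\<lambda>z. Re (\<theta> z)) \<longlongrightarrow> L1) (at p within upper_half_plane)" by blast
  have "\<exists>L. ((\<lambda>z. Im (\<theta> z)) \<longlongrightarrow> L) (at p within upper_half_plane)"
  proof (rule Cauchy_limit_within [OF pcl])
    fix e :: real assume e: "e > 0"
    \<comment> \<open>By the quadratic bound for \<open>cosh\<close>, a move of
      \<open>Im \<theta>\<close> by \<open>e\<close> changes D by at least
      \<open>e\<^sup>2 / 2\<close>; two deviations below \<open>e\<^sup>2 / 4\<close> exclude
      it.\<close>
    obtain d where d: "d > 0" "\<And>z. z \<in> ball p d \<Longrightarrow> \<bar>D z - D p\<bar> < e\<^sup>2 / 4"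
      using near [OF cont(2), of "e\<^sup>2 / 4"] e by auto
    let ?B = "upper_half_plane \<inter> ball p d"
    have key: "Im (\<theta> z') < Im (\<theta> z) + e" if "z \<in> ?B" "z' \<in> ?B" for z z'
    proof (rule ccontr)
      assume "\<not> Im (\<theta> z') < Im (\<theta> z) + e"
      hence le: "Im (\<theta> z) + e \<le> Im (\<theta> z')" by simp
      have "e\<^sup>2 / 2 \<le> (Im (\<theta> z') - Im (\<theta> z))\<^sup>2 / 2" using le e by (intro divide_right_mono power_mono) auto
      also have "\<dots> \<le> cosh (Im (\<theta> z')) - cosh (Im (\<theta> z))" 
        using Imp [of z] that le e by (intro cosh_diff_ge) auto
      also have "\<dots> = (D z' - D p) - (D z - D p)" using D that by simp
      also have "\<dots> < e\<^sup>2 / 2" using d(2) [of z] d(2) [of z'] that by (auto simp: abs_if split: if_splits)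
      finally show False by simp
    qed
    show "\<exists>d>0. \<forall>z\<in>upper_half_plane \<inter> ball p d. \<forall>z'\<in>upper_half_plane \<inter> ball p d. dist (Im (\<theta> z)) (Im (\<theta> z')) < e"
    proof (intro exI conjI ballI)
      fix z z' assume "z \<in> ?B" "z' \<in> ?B"
      thus "dist (Im (\<theta> z)) (Im (\<theta> z')) < e" using key [of z z'] key [of z' z] by (auto simp: dist_real_def abs_if)
    qed (use d in auto)
  qed
  then obtain L2 where L2: "((\<lambda>z. Im (\<theta> z)) \<longlongrightarrow> L2) (at p within upper_half_plane)" by blast
  have "((\<lambda>z. Complex (Re (\<theta> z)) (Im (\<theta> z))) \<longlongrightarrow> Complex L1 L2) (at p within upper_half_plane)"
    by (intro tendsto_Complex L1 L2)
  thus ?thesis by auto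
qed

end

section \<open>The phase on the closed half-plane\<close>

lemma continuous_on_compose_real:
  "continuous_on {z. Im z \<ge> 0} f \<Longrightarrow> continuous_on A (\<lambda>s. f (complex_of_real s))"
  by (rule continuous_on_compose2 [of "{z. Im z \<ge> 0}" f]) (auto intro: continuous_intros)

text \<open>A phase of \<^const>\<open>trig\<close>: its boundary values trace the base and both sides of the slits of a comb.\<close>

locale alternating_phase = alternating_poly +
  fixes \<Theta> :: "complex \<Rightarrow> complex"
  assumes cont: "continuous_on {z. Im z \<ge> 0} \<Theta>"
    and hol: "\<Theta> holomorphic_on upper_half_plane"
    and cos_phase: "\<And>z. Im z \<ge> 0 \<Longrightarrow> cos (\<Theta> z) = T z"
    and Im_phase_pos: "\<And>z. z \<in> upper_half_plane \<Longrightarrow> Im (\<Theta> z) > 0"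
    and Im_phase_nonneg: "\<And>z. Im z \<ge> 0 \<Longrightarrow> Im (\<Theta> z) \<ge> 0"
begin

lemma cos_phase_UHP: "z \<in> upper_half_plane \<Longrightarrow> cos (\<Theta> z) = T z"
  using cos_phase by (simp add: upper_half_plane_def)

lemmas Re_quotient_phase = Re_quotient_UHP [OF hol cos_phase_UHP Im_phase_pos]

lemma phase_inj: "inj_on \<Theta> upper_half_plane"
proof (rule inj_onI, rule ccontr)
  fix a b assume ab: "a \<in> upper_half_plane" "b \<in> upper_half_plane" "\<Theta> a = \<Theta> b" "a \<noteq> b"
  define y where "y = min (Im a) (Im b)"
  have y: "y > 0" using ab by (simp add: y_def upper_half_plane_def)
  have "n * (1 - exp (- 2 * y)) / 8 \<le> Re ((\<Theta> b - \<Theta> a) / (b - a))"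
    by (rule Re_quotient_phase) (use y ab in \<open>auto simp: y_def\<close>)
  moreover have "n * (1 - exp (- 2 * y)) / 8 > 0" using n_pos y by simp
  ultimately show False using ab by simp
qed

lemma vertical_limit:
  "(\<lambda>k. \<Theta> (of_real r + \<i> * of_real (1 / real (Suc k)))) \<longlonglongrightarrow> \<Theta> (of_real r)"
proof -
  have "(\<lambda>k. 1 / real (Suc k)) \<longlonglongrightarrow> 0" using LIMSEQ_Suc [OF lim_1_over_n] by simp
  hence "(\<lambda>k. of_real r + \<i> * of_real (1 / real (Suc k))) \<longlonglongrightarrow> of_real r + \<i> * of_real 0" by (intro tendsto_intros)
  thus ?thesis
    using cont unfolding continuous_on_sequentially by (auto simp: o_def)
qed

text \<open>Horizontal difference quotients at height \<open>y k\<close> have positive real part,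
  but the bound tends to 0 with the height. Only the weak inequality remains, as it must: the real
  part is constant along a slit.\<close>

lemma Re_phase_mono:
  assumes "s \<le> s'" shows "Re (\<Theta> (complex_of_real s)) \<le> Re (\<Theta> (complex_of_real s'))"
proof (cases "s = s'")
  case False
  hence lt: "s < s'" using assms by simp
  define y where "y k = 1 / real (Suc k)" for k
  have y: "y k > 0" for k by (simp add: y_def)
  have lim: "(\<lambda>k. Re (\<Theta> (of_real r + \<i> * of_real (y k)))) \<longlonglongrightarrow> Re (\<Theta> (of_real r))" for r
    unfolding y_def by (intro tendsto_Re vertical_limit)
  show ?thesis
  proof (rule LIMSEQ_le [OF lim lim], intro exI allI impI)
    fix k :: nat
    have "0 \<le> n * (1 - exp (- 2 * y k)) / 8" using y [of k] by simp
    also have "\<dots> \<le> Re ((\<Theta> (of_real s' + \<i> * of_real (y k)) - \<Theta> (of_real s + \<i> * of_real (y k))) / 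
        ((of_real s' + \<i> * of_real (y k)) - (of_real s + \<i> * of_real (y k))))"
      by (rule Re_quotient_phase) (use y lt in auto)
    also have "(of_real s' + \<i> * of_real (y k)) - (of_real s + \<i> * of_real (y k)) = complex_of_real (s' - s)" by simp
    finally show "Re (\<Theta> (of_real s + \<i> * of_real (y k))) \<le> Re (\<Theta> (of_real s' + \<i> * of_real (y k)))"
      using lt by (simp add: Re_divide_of_real zero_le_divide_iff)
  qed
qed simp

lemma phase_real_cases: "sin (Re (\<Theta> (complex_of_real s))) = 0 \<or> Im (\<Theta> (complex_of_real s)) = 0"
  using cos_real_cases [of "\<Theta> (of_real s)"] cos_phase [of "of_real s"] real_on_reals [of s] by simp

text \<open>At alternation points the phase is pi times an integer \<open>p j\<close> of the parity
  of \<open>j\<close>, so monotonicity gives steps of at least 1. A larger step would produce more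
  than \<open>n\<close> zeros of \<open>P\<close>, one between any two consecutive multiples of pi;
  hence all steps are 1.\<close>

lemma phase_alternates:
  obtains p :: int where "even p" "\<And>j. j \<le> n \<Longrightarrow> \<Theta> (of_real (t j)) = of_real (pi * (of_int p + real j))"
proof -
  have "\<exists>p::int. \<Theta> (of_real (t j)) = of_real (pi * of_int p)" if "j \<le> n" for j
  proof -
    have "cos (\<Theta> (of_real (t j))) = 1 \<or> cos (\<Theta> (of_real (t j))) = -1"
      using cos_phase [of "of_real (t j)"] alternates [OF that] by (cases "even j") auto
    thus ?thesis by (metis cos_eq_pm1_imp)
  qed
  then obtain p :: "nat \<Rightarrow> int" where p: "\<And>j. j \<le> n \<Longrightarrow> \<Theta> (of_real (t j)) = of_real (pi * of_int (p j))" by metis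
  have par: "even (p j) \<longleftrightarrow> even j" if "j \<le> n" for j
  proof -
    have "complex_of_real (cos (pi * of_int (p j))) = (-1) ^ j"
      using cos_phase [of "of_real (t j)"] alternates [OF that]
      unfolding p [OF that] cos_of_real [symmetric] by simp
    hence "complex_of_real (cos (pi * of_int (p j))) = of_real ((-1) ^ j)" by (simp only: of_real_power of_real_minus of_real_1)
    hence "cos (pi * of_int (p j)) = (-1) ^ j" by (simp only: of_real_eq_iff)
    thus ?thesis by (cases "even (p j)"; cases "even j") (auto simp: cos_npi_int)
  qed
  have step: "p j + 1 \<le> p (Suc j)" if "j < n" for j
  proof -
    have "pi * of_int (p j) \<le> pi * of_int (p (Suc j))"
      using Re_phase_mono [of "t j" "t (Suc j)"] p [of j] p [of "Suc j"] t_mono [OF that] that by simp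
    hence "p j \<le> p (Suc j)" by simp
    moreover have "p j \<noteq> p (Suc j)" using par [of j] par [of "Suc j"] that by auto
    ultimately show ?thesis by simp
  qed
  have ge: "p i + int (j - i) \<le> p j" if "i \<le> j" "j \<le> n" for i j
    using that
  proof (induction j)
    case (Suc j) thus ?case using step [of j] by (cases "i = Suc j") (auto simp: Suc_diff_le)
  qed simp
  have P0: "P \<noteq> 0" using alternates [of 0] by (auto simp: trig_def)
  have "\<exists>s. t 0 \<le> s \<and> s \<le> t n \<and> Re (\<Theta> (complex_of_real s)) = pi * of_int q + pi / 2" if "q \<in> {p 0..<p n}" for q
  proof (rule IVT')
    have "q + 1 \<le> p n" using that by simp
    hence "pi * of_int (q + 1) \<le> pi * of_int (p n)" by (intro mult_left_mono of_int_le_iff [THEN iffD2]) auto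
    hence "pi * of_int q + pi \<le> pi * of_int (p n)" by (simp add: algebra_simps)
    moreover have "Re (\<Theta> (complex_of_real (t n))) = pi * of_int (p n)" using p [of n] by simp
    ultimately show "pi * of_int q + pi / 2 \<le> Re (\<Theta> (complex_of_real (t n)))" using pi_gt_zero by linarith
    have "pi * of_int (p 0) \<le> pi * of_int q" using that by (intro mult_left_mono of_int_le_iff [THEN iffD2]) auto
    moreover have "Re (\<Theta> (complex_of_real (t 0))) = pi * of_int (p 0)" using p [of 0] by simp
    ultimately show "Re (\<Theta> (complex_of_real (t 0))) \<le> pi * of_int q + pi / 2" using pi_gt_zero by linarith
    show "t 0 \<le> t n" using t_period by simp
    show "continuous_on {t 0..t n} (\<lambda>s. Re (\<Theta> (complex_of_real s)))"
      by (intro continuous_intros continuous_on_compose_real cont)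
  qed
  then obtain s where s: "\<And>q. q \<in> {p 0..<p n} \<Longrightarrow> t 0 \<le> s q \<and> s q \<le> t n \<and> Re (\<Theta> (complex_of_real (s q))) = pi * of_int q + pi / 2"
    by metis
  have cs: "cos (pi * real_of_int q + pi / 2) = 0" "sin (pi * real_of_int q + pi / 2) \<noteq> 0" for q
  proof -
    show c: "cos (pi * real_of_int q + pi / 2) = 0" by (simp add: cos_add sin_npi_int)
    show "sin (pi * real_of_int q + pi / 2) \<noteq> 0" using sin_zero_norm_cos_one c by (metis norm_zero zero_neq_one)
  qed
  \<comment> \<open>Slits stand over multiples of pi only, so at an odd multiple of
    \<open>pi / 2\<close> the phase is real and its cosine vanishes.\<close>
  have root: "T (of_real (s q)) = 0" if "q \<in> {p 0..<p n}" for q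
  proof -
    have "Im (\<Theta> (of_real (s q))) = 0" using phase_real_cases [of "s q"] s [OF that] cs(2) [of q] by auto
    hence "\<Theta> (of_real (s q)) = of_real (pi * of_int q + pi / 2)" using s [OF that] by (simp add: complex_eq_iff)
    hence "T (of_real (s q)) = cos (complex_of_real (pi * of_int q + pi / 2))" using cos_phase [of "of_real (s q)"] by simp
    thus ?thesis using cs(1) [of q] by (simp only: cos_of_real of_real_0)
  qed
  \<comment> \<open>Without the right end, the points lie in a half-open period, where
    \<open>cis\<close> is injective.\<close>
  have neq: "s q \<noteq> t n" if "q \<in> {p 0..<p n}" for q using root [OF that] alternates [of n] by auto
  have "inj_on (\<lambda>q. cis (s q)) {p 0..<p n}"
  proof (rule inj_onI)
    fix q q' assume *: "q \<in> {p 0..<p n}" "q' \<in> {p 0..<p n}" "cis (s q) = cis (s q')"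
    have "s q = s q'"
      by (rule cis_inj_near [OF *(3)]) (use s[OF *(1)] s[OF *(2)] neq[OF *(1)] neq[OF *(2)] t_period in linarith)
    hence "pi * of_int q + pi / 2 = pi * of_int q' + pi / 2" using s [OF *(1)] s [OF *(2)] by metis
    thus "q = q'" by simp
  qed
  hence "card ((\<lambda>q. cis (s q)) ` {p 0..<p n}) = nat (p n - p 0)" by (simp add: card_image)
  moreover have "(\<lambda>q. cis (s q)) ` {p 0..<p n} \<subseteq> {w. poly P w = 0}"
    using root norm_trig_of_real [of n P] by (metis (mono_tags, lifting) image_subsetI mem_Collect_eq norm_eq_zero)
  hence "card ((\<lambda>q. cis (s q)) ` {p 0..<p n}) \<le> degree P"
    using card_mono [OF poly_roots_finite [OF P0]] card_poly_roots_bound [OF P0] order_trans by blast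
  ultimately have le: "p n - p 0 \<le> int n" using deg by linarith
  have pj: "p j = p 0 + int j" if "j \<le> n" for j
    using ge [of 0 j] ge [of j n] that le by simp
  have "\<Theta> (of_real (t j)) = of_real (pi * (of_int (p 0) + real j))" if "j \<le> n" for j
    unfolding p [OF that] pj [OF that] by simp
  thus thesis using that [of "p 0"] par [of 0] by simp
qed

end

section \<open>Existence of a normalised phase\<close>

context alternating_poly
begin

lemma phase_exists:
  obtains \<Theta> where "alternating_phase n P t \<Theta>" "\<And>j. j \<le> n \<Longrightarrow> \<Theta> (of_real (t j)) = of_real (pi * real j)"
proof -
  let ?U = upper_half_plane
  obtain \<theta> where \<theta>: "\<theta> holomorphic_on ?U" "\<And>z. z \<in> ?U \<Longrightarrow> cos (\<theta> z) = T z" "\<And>z. z \<in> ?U \<Longrightarrow> Im (\<theta> z) > 0"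
    using theta_exists by blast
  define \<Theta> where "\<Theta> z = (if z \<in> ?U then \<theta> z else Lim (at z within ?U) \<theta>)" for z
  have eq: "\<Theta> z = \<theta> z" if "z \<in> ?U" for z using that by (simp add: \<Theta>_def)
  have nt: "at z within ?U \<noteq> bot" if "Im z \<ge> 0" for z
  proof (cases "z \<in> ?U")
    case True thus ?thesis unfolding at_within_open [OF True open_UHP] by simp
  next
    case False
    have "z \<in> closure ?U" using that closure_UHP by blast
    hence "z islimpt ?U" using False by (simp add: closure_def)
    thus ?thesis by (simp add: trivial_limit_within)
  qed
  have lim: "(\<theta> \<longlongrightarrow> \<Theta> z) (at z within ?U)" if "Im z \<ge> 0" for z
  proof (cases "z \<in> ?U")
    case True thus ?thesis using holomorphic_on_imp_continuous_on [OF \<theta>(1)] by (simp add: eq continuous_on_def)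
  next
    case False
    hence "Im z = 0" using that by (auto simp: upper_half_plane_def)
    then obtain L where "(\<theta> \<longlongrightarrow> L) (at z within ?U)" using boundary_limit [OF \<theta>] by blast
    thus ?thesis using tendsto_Lim [OF nt [OF that]] False by (auto simp: \<Theta>_def)
  qed
  have cont: "continuous_on {z. Im z \<ge> 0} \<Theta>"
    by (rule continuous_on_limit_extension [OF lim _ _ open_UHP eq]) (auto simp: closure_UHP, auto simp: upper_half_plane_def)
  have cont': "continuous_on (closure ?U) \<Theta>" using cont by (simp add: closure_UHP)
  have hol: "\<Theta> holomorphic_on ?U" using \<theta>(1) eq by (simp cong: holomorphic_cong)
  have cosz: "cos (\<Theta> z) = T z" if "Im z \<ge> 0" for z
  proof -
    have "cos (\<Theta> z) - T z = 0"
    proof (rule continuous_constant_on_closure [where f = "\<lambda>z. cos (\<Theta> z) - T z"])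
      show "continuous_on (closure ?U) (\<lambda>z. cos (\<Theta> z) - T z)"
        by (intro continuous_intros trig_continuous cont')
    qed (use that eq \<theta> closure_UHP in auto)
    thus ?thesis by simp
  qed
  have Im0: "Im (\<Theta> z) \<ge> 0" if "Im z \<ge> 0" for z
  proof -
    have "eventually (\<lambda>z. 0 \<le> Im (\<theta> z)) (at z within ?U)"
      unfolding eventually_at using \<theta>(3) by (auto intro!: exI [of _ 1] less_imp_le)
    thus ?thesis using tendsto_lowerbound [OF tendsto_Im [OF lim [OF that]] _ nt [OF that]] by blast
  qed
  interpret alternating_phase n P t \<Theta>
    by standard (use cont hol cosz Im0 eq \<theta> in auto)
  obtain p :: int where p: "even p" "\<And>j. j \<le> n \<Longrightarrow> \<Theta> (of_real (t j)) = of_real (pi * (of_int p + real j))"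
    using phase_alternates by blast
  obtain k where k: "p = 2 * k" using p(1) by blast
  \<comment> \<open>Since \<open>p\<close> is even, the subtraction preserves the cosine; it moves
    the value at \<open>t 0\<close> to 0.\<close>
  define \<Theta>' where "\<Theta>' z = \<Theta> z - of_real (pi * of_int p)" for z
  have cos': "cos (\<Theta>' z) = cos (\<Theta> z)" for z
    using cos.minus_of_int [of "\<Theta> z" k] by (simp add: \<Theta>'_def k mult_ac)
  have Im': "Im (\<Theta>' z) = Im (\<Theta> z)" for z by (simp add: \<Theta>'_def)
  have "continuous_on {z. Im z \<ge> 0} \<Theta>'" "\<Theta>' holomorphic_on ?U"
    unfolding \<Theta>'_def by (intro continuous_intros cont, intro holomorphic_intros hol)
  hence "alternating_phase n P t \<Theta>'"
    by unfold_locales (simp_all add: cos' cosz Im' Im0 Im_phase_pos)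
  moreover have "\<Theta>' (of_real (t j)) = of_real (pi * real j)" if "j \<le> n" for j
    using p(2) [OF that] by (simp add: \<Theta>'_def algebra_simps)
  ultimately show thesis using that by blast
qed

end

lemma sin_eq_0_pi_multiple: 
  fixes r :: real assumes "sin r = 0" obtains k :: int where "r = pi * of_int k"
  using assms by (auto simp: sin_zero_iff_int2 mult.commute)

subsection \<open>The image of the phase\<close>

locale comb_phase = alternating_phase +
  assumes normalized: "\<And>j. j \<le> n \<Longrightarrow> \<Theta> (of_real (t j)) = of_real (pi * real j)"
begin

abbreviation \<Theta>r :: "real \<Rightarrow> complex" where "\<Theta>r s \<equiv> \<Theta> (complex_of_real s)"

text \<open>Both sides have the same cosine, so they agree up to sign and a multiple of
  \<open>2 * pi\<close>. Positive imaginary parts exclude the sign; the multiple is continuous with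
  discrete values, hence constant, and it is 0 at \<open>t 0\<close>.\<close>

lemma phase_plus_2pi:
  assumes "Im z \<ge> 0" shows "\<Theta> (z + 2 * of_real pi) = \<Theta> z + of_nat n * of_real pi"
proof -
  let ?U = upper_half_plane
  define d where "d z = \<Theta> (z + 2 * of_real pi) - \<Theta> z - of_nat n * of_real pi" for z
  have contd: "continuous_on (closure ?U) d"
    unfolding d_def closure_UHP by (intro continuous_intros cont continuous_on_compose2 [OF cont]) auto
  have dU: "\<exists>m::int. d z = of_real (2 * pi * of_int m)" if z: "z \<in> ?U" for z
  proof -
    have z': "z + 2 * of_real pi \<in> ?U" using z by (simp add: upper_half_plane_def)
    have "cos (\<Theta> (z + 2 * of_real pi)) = (-1) ^ n * cos (\<Theta> z)"
      using cos_phase_UHP [OF z] cos_phase_UHP [OF z'] by (simp add: trig_plus_2pi)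
    also have "\<dots> = cos (\<Theta> z + of_nat n * of_real pi)"
    proof -
      have "cos (of_nat n * complex_of_real pi) = (-1) ^ n" "sin (of_nat n * complex_of_real pi) = 0"
        by (metis cos_npi cos_of_real of_real_1 of_real_minus of_real_mult of_real_of_nat_eq of_real_power,
            metis sin_npi sin_of_real of_real_0 of_real_mult of_real_of_nat_eq)
      thus ?thesis by (simp add: cos_add)
    qed
    finally obtain m :: real where m: "m \<in> \<int>" "\<Theta> (z + 2 * of_real pi) = (\<Theta> z + of_nat n * of_real pi) + of_real (2 * m * pi) \<or>
        \<Theta> (z + 2 * of_real pi) = - (\<Theta> z + of_nat n * of_real pi) + of_real (2 * m * pi)"
      unfolding complex_cos_eq by blast
    have "\<Theta> (z + 2 * of_real pi) \<noteq> - (\<Theta> z + of_nat n * of_real pi) + of_real (2 * m * pi)"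
    proof
      assume "\<Theta> (z + 2 * of_real pi) = - (\<Theta> z + of_nat n * of_real pi) + of_real (2 * m * pi)"
      hence "Im (\<Theta> (z + 2 * of_real pi)) = - Im (\<Theta> z)" by simp
      thus False using Im_phase_pos [OF z] Im_phase_pos [OF z'] by simp
    qed
    hence "d z = of_real (2 * pi * m)" using m(2) by (simp add: d_def)
    thus ?thesis using m(1) by (auto elim!: Ints_cases)
  qed
  have "d constant_on ?U"
  proof (rule continuous_discrete_range_constant)
    show "connected ?U" using convex_UHP convex_connected by blast
    show "continuous_on ?U d" using contd closure_subset continuous_on_subset by blast
    fix a assume a: "a \<in> ?U"
    show "\<exists>e>0. \<forall>b. b \<in> ?U \<and> d b \<noteq> d a \<longrightarrow> e \<le> norm (d b - d a)"
    proof (intro exI [of _ "2 * pi"] conjI allI impI)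
      fix b assume b: "b \<in> ?U \<and> d b \<noteq> d a"
      obtain m m' :: int where m: "d a = of_real (2 * pi * of_int m)" "d b = of_real (2 * pi * of_int m')"
        using dU a b by metis
      have "d b - d a = of_real (2 * pi * of_int (m' - m))" by (simp add: m algebra_simps)
      hence "norm (d b - d a) = 2 * pi * \<bar>of_int (m' - m)\<bar>" by (simp only: norm_of_real) (simp add: abs_mult)
      moreover have "m' \<noteq> m" using b m by auto
      hence "1 \<le> \<bar>real_of_int (m' - m)\<bar>" by linarith
      hence "2 * pi * 1 \<le> 2 * pi * \<bar>real_of_int (m' - m)\<bar>" by (intro mult_left_mono) auto
      ultimately show "2 * pi \<le> norm (d b - d a)" by simp
    qed simp
  qed
  then obtain K where K: "\<And>z. z \<in> ?U \<Longrightarrow> d z = K" by (auto simp: constant_on_def)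
  have dK: "d z = K" if "Im z \<ge> 0" for z
    by (rule continuous_constant_on_closure [OF contd K]) (use that closure_UHP in auto)
  have "d (of_real (t 0)) = 0"
    using normalized [of 0] normalized [of n] t_period by (simp add: d_def)
  hence "K = 0" using dK [of "of_real (t 0)"] by simp
  thus ?thesis using dK [OF assms] by (simp add: d_def algebra_simps)
qed

lemma phase_plus_nat:
  assumes "Im z \<ge> 0" shows "\<Theta> (z + of_real (2 * pi * real m)) = \<Theta> z + of_real (pi * n * real m)"
proof (induction m)
  case (Suc m)
  have "\<Theta> (z + of_real (2 * pi * real (Suc m))) = \<Theta> ((z + of_real (2 * pi * real m)) + 2 * of_real pi)"
    by (simp add: algebra_simps)
  also have "\<dots> = \<Theta> (z + of_real (2 * pi * real m)) + of_nat n * of_real pi"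
    by (rule phase_plus_2pi) (use assms in simp)
  finally show ?case using Suc by (simp add: algebra_simps)
qed simp

lemma phase_plus_int:
  assumes "Im z \<ge> 0" shows "\<Theta> (z + of_real (2 * pi * of_int m)) = \<Theta> z + of_real (pi * n * of_int m)"
proof (cases "m \<ge> 0")
  case True thus ?thesis using phase_plus_nat [OF assms, of "nat m"] by simp
next
  case False
  have "\<Theta> ((z + of_real (2 * pi * of_int m)) + of_real (2 * pi * real (nat (- m)))) =
     \<Theta> (z + of_real (2 * pi * of_int m)) + of_real (pi * n * real (nat (- m)))"
    by (rule phase_plus_nat) (use assms in simp)
  thus ?thesis using False by (simp add: algebra_simps)
qed

lemma phase_real_plus_int: "\<Theta>r (s + 2 * pi * of_int m) = \<Theta>r s + of_real (pi * n * of_int m)"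
  using phase_plus_int [of "of_real s" m] by simp


lemma phase_hits_base: obtains s where "\<Theta>r s = of_real (pi * of_int k)"
proof -
  define j where "j = nat (k mod int n)"
  have "0 \<le> k mod int n" "k mod int n < int n" using n_pos by simp_all
  hence j: "j \<le> n" "int j = k mod int n" by (auto simp: j_def nat_le_iff)
  have "\<Theta>r (t j + 2 * pi * of_int (k div int n)) = of_real (pi * real j) + of_real (pi * n * of_int (k div int n))"
    by (simp only: phase_real_plus_int normalized [OF j(1)])
  also have "\<dots> = of_real (pi * of_int (int j + int n * (k div int n)))" by (simp add: algebra_simps)
  also have "int j + int n * (k div int n) = k" by (simp add: j)
  finally show thesis using that by blast
qed

text \<open>Between a parameter over the base point and \<open>s\<close> the real part is monotone
  with equal end values, hence constant, while the imaginary part takes all intermediate values. So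
  the boundary curve contains everything below any of its points on a slit.\<close>

lemma phase_down:
  assumes "\<Theta>r s = Complex (pi * of_int k) \<eta>" "0 \<le> \<eta>'" "\<eta>' \<le> \<eta>"
  obtains s' where "\<Theta>r s' = Complex (pi * of_int k) \<eta>'"
proof -
  obtain s0 where s0: "\<Theta>r s0 = of_real (pi * of_int k)" using phase_hits_base by blast
  have conn: "connected ((\<lambda>r. Im (\<Theta>r r)) ` closed_segment s0 s)"
    by (intro connected_continuous_image continuous_intros continuous_on_compose_real cont) auto
  have "\<eta>' \<in> (\<lambda>r. Im (\<Theta>r r)) ` closed_segment s0 s"
    by (rule connectedD_interval [OF conn imageI [of s0] imageI [of s]]) (use assms s0 in auto)
  then obtain r where r: "r \<in> closed_segment s0 s" "Im (\<Theta>r r) = \<eta>'" by auto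
  have "Re (\<Theta>r r) = pi * of_int k"
  proof (cases "s0 \<le> s")
    case True
    hence "s0 \<le> r" "r \<le> s" using r(1) by (auto simp: closed_segment_eq_real_ivl)
    thus ?thesis using Re_phase_mono [of s0 r] Re_phase_mono [of r s] s0 assms by simp
  next
    case False
    hence "s \<le> r" "r \<le> s0" using r(1) by (auto simp: closed_segment_eq_real_ivl)
    thus ?thesis using Re_phase_mono [of s r] Re_phase_mono [of r s0] s0 assms by simp
  qed
  thus thesis using that [of r] r(2) by (simp add: complex_eq_iff)
qed

lemma phase_slit:
  assumes "Im (\<Theta>r s) > 0" obtains k :: int where "\<Theta>r s = Complex (pi * of_int k) (Im (\<Theta>r s))"
proof -
  have "sin (Re (\<Theta>r s)) = 0" using phase_real_cases [of s] assms by auto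
  then obtain k :: int where "Re (\<Theta>r s) = pi * of_int k" by (rule sin_eq_0_pi_multiple)
  thus thesis using that by (simp add: complex_eq_iff)
qed

lemma phase_Im_bounded: obtains B where "\<And>s. Im (\<Theta>r s) \<le> B"
proof -
  have "compact ((\<lambda>s. Im (\<Theta>r s)) ` {0..2 * pi})"
    by (intro compact_continuous_image continuous_intros continuous_on_compose_real cont) auto
  then obtain B where B: "\<And>s. s \<in> {0..2 * pi} \<Longrightarrow> \<bar>Im (\<Theta>r s)\<bar> \<le> B"
    by (metis (no_types, lifting) bounded_iff compact_imp_bounded image_eqI real_norm_def)
  have "Im (\<Theta>r s) \<le> B" for s
  proof -
    obtain s' and m :: int where s': "0 \<le> s'" "s' < 0 + 2 * pi" "s = s' + 2 * pi * of_int m"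
      by (rule shift_mod_2pi)
    have "Im (\<Theta>r s) = Im (\<Theta>r s')" unfolding s'(3) phase_real_plus_int by simp
    thus ?thesis using B [of s'] s' by simp
  qed
  thus thesis using that by blast
qed

text \<open>Properness of the phase: upwards its imaginary part grows at least linearly by the bound
  on difference quotients, and sideways each period adds \<open>pi * n\<close>.\<close>

lemma phase_bounded_preimage:
  obtains K where "compact K" "K \<subseteq> {z. Im z \<ge> 0}" "\<And>z. Im z \<ge> 0 \<Longrightarrow> norm (\<Theta> z) \<le> M \<Longrightarrow> z \<in> K"
proof -
  \<comment> \<open>The lower bound for difference quotients at heights of at least 1.\<close>
  define c where "c = n * (1 - exp (- 2 * 1)) / 8"
  have c: "c > 0" using n_pos by (simp add: c_def)
  define Y where "Y = 1 + \<bar>M\<bar> / c"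
  have ImY: "Im z \<le> Y" if z: "Im z \<ge> 0" "norm (\<Theta> z) \<le> M" for z
  proof (cases "Im z > 1")
    case True
    define a where "a = Complex (Re z) 1"
    have az: "z - a = \<i> * of_real (Im z - 1)" by (simp add: a_def complex_eq_iff)
    have "c \<le> Re ((\<Theta> z - \<Theta> a) / (z - a))" unfolding c_def
      by (rule Re_quotient_phase) (use True in \<open>auto simp: a_def complex_eq_iff\<close>)
    also have "(\<Theta> z - \<Theta> a) / (z - a) = - \<i> * (\<Theta> z - \<Theta> a) / of_real (Im z - 1)"
      unfolding az using True by (simp add: field_simps)
    also have "Re \<dots> = (Im (\<Theta> z) - Im (\<Theta> a)) / (Im z - 1)" unfolding Re_divide_of_real by simp
    finally have "c * (Im z - 1) \<le> Im (\<Theta> z) - Im (\<Theta> a)" using True by (simp add: field_simps)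
    also have "\<dots> \<le> \<bar>M\<bar>" using Im_phase_nonneg [of a] abs_Im_le_cmod [of "\<Theta> z"] z by (simp add: a_def)
    finally show ?thesis using c by (simp add: Y_def field_simps)
  next
    case False thus ?thesis using c by (simp add: Y_def add_increasing2)
  qed
  have "compact (\<Theta> ` cbox 0 (Complex (2 * pi) Y))"
    by (intro compact_continuous_image continuous_on_subset [OF cont] compact_cbox) (auto simp: in_cbox_complex_iff)
  then obtain B where B: "\<And>z. z \<in> cbox 0 (Complex (2 * pi) Y) \<Longrightarrow> norm (\<Theta> z) \<le> B"
    by (metis (no_types, lifting) bounded_iff compact_imp_bounded image_eqI)
  \<comment> \<open>Since \<open>pi * n\<close> is at least 1, \<open>z\<close> is at most |M| + |B|
    periods away from its representative in the first one.\<close>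
  define X where "X = 2 * pi + 2 * pi * (\<bar>M\<bar> + \<bar>B\<bar>)"
  show thesis
  proof (rule that [of "cbox (Complex (- X) 0) (Complex X Y)"])
    show "cbox (Complex (- X) 0) (Complex X Y) \<subseteq> {z. Im z \<ge> 0}" by (auto simp: in_cbox_complex_iff)
    fix z assume z: "Im z \<ge> 0" "norm (\<Theta> z) \<le> M"
    obtain s' and m :: int where s': "0 \<le> s'" "s' < 0 + 2 * pi" "Re z = s' + 2 * pi * of_int m"
      by (rule shift_mod_2pi)
    define a where "a = Complex s' (Im z)"
    have za: "z = a + of_real (2 * pi * of_int m)" using s' by (simp add: a_def complex_eq_iff)
    have "\<Theta> z = \<Theta> a + of_real (pi * n * of_int m)" unfolding za by (rule phase_plus_int) (use z in \<open>simp add: a_def\<close>)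
    hence "complex_of_real (pi * n * of_int m) = \<Theta> z - \<Theta> a" by simp
    hence "norm (complex_of_real (pi * n * of_int m)) \<le> norm (\<Theta> z) + norm (\<Theta> a)" by (metis norm_triangle_ineq4)
    moreover have "norm (\<Theta> a) \<le> B" using B [of a] s' ImY [OF z] z by (simp add: a_def in_cbox_complex_iff)
    ultimately have "pi * n * \<bar>of_int m\<bar> \<le> \<bar>M\<bar> + \<bar>B\<bar>" using z(2) by (simp add: norm_mult)
    moreover have "1 * \<bar>real_of_int m\<bar> \<le> (pi * n) * \<bar>of_int m\<bar>"
    proof (rule mult_right_mono)
      have "1 * 1 \<le> pi * real n" using n_pos pi_gt3 by (intro mult_mono) auto
      thus "1 \<le> pi * real n" by simp
    qed simp
    ultimately have "\<bar>real_of_int m\<bar> \<le> \<bar>M\<bar> + \<bar>B\<bar>" by linarith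
    hence "2 * pi * \<bar>real_of_int m\<bar> \<le> 2 * pi * (\<bar>M\<bar> + \<bar>B\<bar>)" by (intro mult_left_mono) auto
    moreover have "\<bar>2 * pi * real_of_int m\<bar> = 2 * pi * \<bar>real_of_int m\<bar>" by (simp add: abs_mult)
    ultimately have "\<bar>Re z\<bar> \<le> X" using s' unfolding X_def by linarith
    thus "z \<in> cbox (Complex (- X) 0) (Complex X Y)" using ImY [OF z] z by (auto simp: in_cbox_complex_iff abs_le_iff)
  qed (rule compact_cbox)
qed

text \<open>By the open mapping theorem a ball around \<open>z0\<close> covers a neighbourhood of
  the common value. Points just above \<open>s\<close> have values in it, and these would be
  attained twice, inside the ball and close to the real line.\<close>

lemma phase_UHP_disjoint:
  assumes "z0 \<in> upper_half_plane" shows "\<Theta> z0 \<noteq> \<Theta>r s"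
proof
  assume eq: "\<Theta> z0 = \<Theta>r s"
  define r where "r = Im z0 / 2"
  have r: "r > 0" using assms by (simp add: r_def upper_half_plane_def)
  have Imb: "Im z > r" if "z \<in> ball z0 r" for z
    using that abs_Im_le_cmod [of "z0 - z"] by (simp add: dist_norm r_def abs_if split: if_splits)
  hence sub: "ball z0 r \<subseteq> upper_half_plane" using r by (auto simp: upper_half_plane_def intro: less_trans)
  have "open (\<Theta> ` ball z0 r)"
    by (rule open_mapping_thm3) (use sub hol phase_inj holomorphic_on_subset inj_on_subset in blast)+
  moreover have "\<Theta>r s \<in> \<Theta> ` ball z0 r" using eq r by (metis centre_in_ball image_eqI)
  ultimately have "eventually (\<lambda>k. \<Theta> (of_real s + \<i> * of_real (1 / real (Suc k))) \<in> \<Theta> ` ball z0 r) sequentially"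
    using topological_tendstoD [OF vertical_limit] by blast
  moreover have "eventually (\<lambda>k. 1 / real (Suc k) < r) sequentially"
    using LIMSEQ_Suc [OF lim_1_over_n] r order_tendstoD(2) by fastforce
  ultimately obtain k where k: "\<Theta> (of_real s + \<i> * of_real (1 / real (Suc k))) \<in> \<Theta> ` ball z0 r" "1 / real (Suc k) < r"
    using eventually_happens [OF eventually_conj] trivial_limit_sequentially by blast
  define z where "z = of_real s + \<i> * complex_of_real (1 / real (Suc k))"
  have "Im z = 1 / real (Suc k)" by (simp add: z_def)
  hence Imz: "Im z > 0" "Im z < r" using k(2) by auto
  obtain z' where z': "z' \<in> ball z0 r" "\<Theta> z = \<Theta> z'" using k(1) unfolding z_def by blast
  have "z = z'" by (rule inj_onD [OF phase_inj z'(2)]) (use z' sub Imz in \<open>auto simp: upper_half_plane_def\<close>)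
  thus False using Imb [OF z'(1)] Imz by simp
qed

text \<open>A vertical ray upwards from a point off the boundary curve never meets the curve, since
  \<open>phase_down\<close> would put the starting point itself on it. All these rays reach the
  half-plane \<open>C\<close> above every slit.\<close>

lemma connected_slit_plane: "connected (upper_half_plane - range \<Theta>r)"
proof -
  let ?W = "upper_half_plane - range \<Theta>r"
  obtain B where B: "\<And>s. Im (\<Theta>r s) \<le> B" using phase_Im_bounded by blast
  define C where "C = {z. Im z > max B 0}"
  have C: "connected C" "C \<subseteq> ?W"
  proof -
    show "connected C" unfolding C_def by (intro convex_connected convex_halfspace_Im_gt)
    show "C \<subseteq> ?W"
    proof
      fix z assume "z \<in> C"
      moreover from this have "z \<noteq> \<Theta>r s" for s using B [of s] by (auto simp: C_def)
      ultimately show "z \<in> ?W" by (auto simp: C_def upper_half_plane_def)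
    qed
  qed
  define V where "V q = (\<lambda>y. q + \<i> * of_real y) ` {0..}" for q
  have V: "connected (V q)" "V q \<subseteq> ?W" "q \<in> V q" "V q \<inter> C \<noteq> {}" if q: "q \<in> ?W" for q
  proof -
    show "connected (V q)" unfolding V_def by (intro connected_continuous_image continuous_intros) auto
    show "q \<in> V q" unfolding V_def by (auto intro!: image_eqI [of _ _ 0])
    have "q + \<i> * of_real (\<bar>B\<bar> + 1) \<in> V q" unfolding V_def by (rule imageI) simp
    moreover have "q + \<i> * of_real (\<bar>B\<bar> + 1) \<in> C" using q by (auto simp: C_def upper_half_plane_def)
    ultimately have "q + \<i> * of_real (\<bar>B\<bar> + 1) \<in> V q \<inter> C" by blast
    thus "V q \<inter> C \<noteq> {}" by blast
    show "V q \<subseteq> ?W"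
    proof
      fix u assume "u \<in> V q"
      then obtain y where y: "y \<ge> 0" "u = q + \<i> * of_real y" by (auto simp: V_def)
      have Imq: "Im q > 0" using q by (simp add: upper_half_plane_def)
      have "u \<notin> range \<Theta>r"
      proof
        assume "u \<in> range \<Theta>r"
        then obtain s where s: "u = \<Theta>r s" by blast
        have Ims: "Im (\<Theta>r s) = Im q + y" "Re (\<Theta>r s) = Re q" using y s [symmetric] by simp_all
        then obtain k :: int where k: "\<Theta>r s = Complex (pi * of_int k) (Im (\<Theta>r s))"
          using phase_slit [of s] Imq y by (metis add_pos_nonneg)
        then obtain s' where "\<Theta>r s' = Complex (pi * of_int k) (Im q)"
          using phase_down [OF k, of "Im q"] Imq y Ims by auto
        moreover have "Re q = pi * of_int k" using Ims k by (metis complex.sel(1))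
        ultimately have "\<Theta>r s' = q" by (simp add: complex_eq_iff)
        thus False using q by blast
      qed
      thus "u \<in> ?W" using Imq y by (simp add: upper_half_plane_def)
    qed
  qed
  show ?thesis unfolding connected_iff_connected_component
  proof (intro ballI)
    fix a b assume a: "a \<in> ?W" and b: "b \<in> ?W"
    have "connected (V a \<union> C)" by (rule connected_Un [OF V(1) [OF a] C(1) V(4) [OF a]])
    hence "connected ((V a \<union> C) \<union> V b)" by (rule connected_Un [OF _ V(1) [OF b]]) (use V(4) [OF b] in blast)
    thus "connected_component ?W a b"
      unfolding connected_component_def using V(2,3) [OF a] V(2,3) [OF b] C(2) by (intro exI [of _ "(V a \<union> C) \<union> V b"]) auto
  qed
qed

text \<open>The image is open in the slit half-plane, and by properness it is closed there: a limit
  of values has a preimage in the closed half-plane, which is not real because the limit avoids the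
  boundary curve. Connectedness gives equality.\<close>

lemma phase_bij: "bij_betw \<Theta> upper_half_plane (upper_half_plane - range \<Theta>r)"
  unfolding bij_betw_def
proof (intro conjI phase_inj)
  let ?W = "upper_half_plane - range \<Theta>r" and ?A = "\<Theta> ` upper_half_plane"
  have sub: "?A \<subseteq> ?W"
    using phase_UHP_disjoint Im_phase_pos by (fastforce simp: upper_half_plane_def)
  have "open ?A" by (rule open_mapping_thm3 [OF hol open_UHP phase_inj])
  hence op: "openin (top_of_set ?W) ?A" using sub by (simp add: open_subset)
  have "?W \<inter> closure ?A \<subseteq> ?A"
  proof
    fix p assume p: "p \<in> ?W \<inter> closure ?A"
    obtain K where K: "compact K" "K \<subseteq> {z. Im z \<ge> 0}" "\<And>z. Im z \<ge> 0 \<Longrightarrow> norm (\<Theta> z) \<le> norm p + 1 \<Longrightarrow> z \<in> K"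
      using phase_bounded_preimage [of "norm p + 1"] by blast
    have "p \<in> closure (ball p 1 \<inter> ?A)"
      using open_Int_closure_subset [OF open_ball [of p 1], of ?A] p by auto
    moreover have "ball p 1 \<inter> ?A \<subseteq> \<Theta> ` K"
    proof
      fix u assume u: "u \<in> ball p 1 \<inter> ?A"
      then obtain z where z: "u = \<Theta> z" "z \<in> upper_half_plane" by blast
      have "norm u \<le> norm p + 1" using u norm_triangle_ineq2 [of u p] by (simp add: dist_norm norm_minus_commute)
      thus "u \<in> \<Theta> ` K" using z K(3) [of z] by (simp add: upper_half_plane_def)
    qed
    moreover have "closed (\<Theta> ` K)"
      by (intro compact_imp_closed compact_continuous_image K continuous_on_subset [OF cont])
    ultimately have "p \<in> \<Theta> ` K" using closure_minimal by blast
    then obtain z where z: "z \<in> K" "p = \<Theta> z" by blast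
    have "Im z \<noteq> 0"
    proof
      assume "Im z = 0"
      hence "z = of_real (Re z)" by (simp add: complex_eq_iff)
      hence "p = \<Theta>r (Re z)" using z by simp
      thus False using p by blast
    qed
    hence "z \<in> upper_half_plane" using K(2) z(1) by (force simp: upper_half_plane_def)
    thus "p \<in> ?A" using z by blast
  qed
  hence "?A = ?W \<inter> closure ?A" by (intro equalityI Int_greatest sub closure_subset)
  hence cl: "closedin (top_of_set ?W) ?A" unfolding closedin_closed using closed_closure by blast
  have "\<i> \<in> upper_half_plane" by (simp add: upper_half_plane_def)
  hence "?A \<noteq> {}" by blast
  moreover have "?A = {} \<or> ?A = ?W"
    using connected_slit_plane [unfolded connected_clopen, rule_format, OF conjI, OF op cl] .
  ultimately show "?A = ?W" by simp
qed

text \<open>For \<open>k < n\<close> the fibre contains \<open>t k\<close>, with imaginary part 0;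
  height 0 means that no slit stands there.\<close>

definition height :: "nat \<Rightarrow> real" where
  "height k = Sup {Im (\<Theta>r s) |s. Re (\<Theta>r s) = pi * real k}"

text \<open>Monotonicity confines the fibre to two periods, so it is compact and the supremum is
  attained, at the tip of the slit.\<close>

lemma height_props:
  assumes "k < n"
  shows "\<And>s. Re (\<Theta>r s) = pi * real k \<Longrightarrow> Im (\<Theta>r s) \<le> height k"
    and "\<exists>s. \<Theta>r s = Complex (pi * real k) (height k)"
proof -
  define I where "I = {s. Re (\<Theta>r s) = pi * real k}"
  have im: "{Im (\<Theta>r s) |s. Re (\<Theta>r s) = pi * real k} = (\<lambda>s. Im (\<Theta>r s)) ` I" by (auto simp: I_def)
  have "I \<subseteq> {t 0 - 2 * pi..t 0 + 2 * pi}"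
  proof
    fix s assume s: "s \<in> I"
    have hi: "Re (\<Theta>r (t 0 + 2 * pi)) = pi * n" using normalized [of n] t_period by simp
    have lo: "Re (\<Theta>r (t 0 - 2 * pi)) = - (pi * n)" using phase_real_plus_int [of "t 0" "-1"] normalized [of 0] by simp
    have "pi * real k < pi * n" using assms by simp
    hence "\<not> t 0 + 2 * pi \<le> s" using Re_phase_mono [of "t 0 + 2 * pi" s] hi s by (auto simp: I_def)
    moreover have "- (pi * n) < pi * real k" using n_pos by (smt (verit) mult_nonneg_nonneg of_nat_0_le_iff pi_ge_zero \<open>pi * real k < pi * n\<close>)
    hence "\<not> s \<le> t 0 - 2 * pi" using Re_phase_mono [of s "t 0 - 2 * pi"] lo s by (auto simp: I_def)
    ultimately show "s \<in> {t 0 - 2 * pi..t 0 + 2 * pi}" by simp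
  qed
  moreover have "closed I" unfolding I_def
    by (intro closed_Collect_eq continuous_intros continuous_on_compose_real cont)
  ultimately have "compact I" by (metis bounded_closed_interval bounded_subset compact_eq_bounded_closed)
  hence cpt: "compact ((\<lambda>s. Im (\<Theta>r s)) ` I)"
    by (intro compact_continuous_image continuous_intros continuous_on_compose_real cont)
  have "t k \<in> I" using normalized [of k] assms by (simp add: I_def)
  hence ne: "(\<lambda>s. Im (\<Theta>r s)) ` I \<noteq> {}" by blast
  have "height k \<in> (\<lambda>s. Im (\<Theta>r s)) ` I"
    unfolding height_def im by (rule closed_contains_Sup) (use cpt ne in \<open>auto intro: bounded_imp_bdd_above compact_imp_bounded compact_imp_closed\<close>)
  thus "\<exists>s. \<Theta>r s = Complex (pi * real k) (height k)" by (auto simp: I_def complex_eq_iff)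
  show "Im (\<Theta>r s) \<le> height k" if "Re (\<Theta>r s) = pi * real k" for s
    unfolding height_def im by (rule cSup_upper) (use that cpt in \<open>auto simp: I_def intro: bounded_imp_bdd_above compact_imp_bounded\<close>)
qed

text \<open>Comb data admit positive heights only. The factor \<open>2 / n\<close> converts base
  points \<open>pi * k\<close> into \<open>2 * pi * k / n\<close>.\<close>

definition slits :: "(real \<times> real) set" where
  "slits = (\<lambda>k. (2 * pi * real k / real n, 2 * height k / real n)) ` {k. k < n \<and> height k > 0}"

lemma slits_regular: "regular_comb_data n slits"
proof -
  have "real n * (2 * pi * real k / real n) / (2 * pi) = real k" "2 * pi * real k / real n < 2 * pi" if "k < n" for k
    using n_pos that by (simp_all add: field_simps)
  thus ?thesis using n_pos unfolding regular_comb_data_def slits_def by auto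
qed

text \<open>Division with remainder by \<open>n\<close> splits the index of a base point into a slit
  and a number of periods. One direction fills the slit by \<open>phase_down\<close>, the other uses
  that \<open>height\<close> bounds the fibre.\<close>

lemma slit_iff:
  assumes "Im q > 0"
  shows "(\<exists>(\<omega>, h)\<in>slits. \<exists>m\<in>\<int>. \<exists>\<eta>. q = complex_of_real (\<omega> + 2 * pi * m) + \<i> * complex_of_real \<eta> \<and> 0 < \<eta> \<and> \<eta> \<le> h)
     \<longleftrightarrow> of_nat n / 2 * q \<in> range \<Theta>r" (is "?L \<longleftrightarrow> ?R")
proof
  assume ?L
  then obtain k and m :: int and \<eta> where k: "k < n" "height k > 0" and \<eta>: "0 < \<eta>" "\<eta> \<le> 2 * height k / real n"
    and q: "q = complex_of_real (2 * pi * real k / real n + 2 * pi * of_int m) + \<i> * complex_of_real \<eta>"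
    by (auto simp: slits_def elim!: Ints_cases)
  obtain s where s: "\<Theta>r s = Complex (pi * of_int (int k)) (height k)" using height_props(2) [OF k(1)] by auto
  have le: "n * \<eta> / 2 \<le> height k" "0 \<le> n * \<eta> / 2" using \<eta> n_pos by (simp_all add: field_simps)
  obtain s' where s': "\<Theta>r s' = Complex (pi * of_int (int k)) (n * \<eta> / 2)"
    using phase_down [OF s le(2,1)] by blast
  have "\<Theta>r (s' + 2 * pi * of_int m) = of_nat n / 2 * q"
    unfolding phase_real_plus_int s' q using n_pos by (simp add: complex_eq_iff field_simps)
  thus ?R by (metis rangeI)
next
  assume ?R
  then obtain s where s: "\<Theta>r s = of_nat n / 2 * q" by (metis rangeE)
  have Im: "Im (\<Theta>r s) = n / 2 * Im q" unfolding s by simp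
  have "Im (\<Theta>r s) > 0" unfolding Im using assms n_pos by simp
  then obtain K :: int where K: "\<Theta>r s = Complex (pi * of_int K) (Im (\<Theta>r s))" by (rule phase_slit)
  define k where "k = nat (K mod int n)"
  define m where "m = K div int n"
  have k: "k < n" "int k = K mod int n" using n_pos by (auto simp: k_def nat_less_iff)
  have Kkm: "K = int k + int n * m" by (simp add: k m_def)
  define s' where "s' = s + 2 * pi * of_int (- m)"
  have s': "\<Theta>r s' = \<Theta>r s + of_real (pi * n * of_int (- m))" unfolding s'_def by (rule phase_real_plus_int)
  have "Re (\<Theta>r s) = pi * of_int K" using K by (metis complex.sel(1))
  hence "Re (\<Theta>r s') = pi * real k" unfolding s' by (simp add: Kkm algebra_simps)
  hence le: "Im (\<Theta>r s) \<le> height k" using height_props(1) [OF k(1), of s'] s' by simp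
  hence "height k > 0" using \<open>Im (\<Theta>r s) > 0\<close> by simp
  hence mem: "(2 * pi * real k / real n, 2 * height k / real n) \<in> slits" using k by (auto simp: slits_def)
  have "n / 2 * Re q = pi * of_int K" using \<open>Re (\<Theta>r s) = pi * of_int K\<close> unfolding s by simp
  hence "Re q = 2 * pi * real k / real n + 2 * pi * of_int m" using n_pos by (simp add: Kkm field_simps)
  hence "q = complex_of_real (2 * pi * real k / real n + 2 * pi * of_int m) + \<i> * complex_of_real (Im q)"
    by (simp add: complex_eq_iff)
  moreover have "Im q \<le> 2 * height k / real n" using le Im n_pos by (simp add: field_simps)
  ultimately have "\<exists>\<eta>. q = complex_of_real (2 * pi * real k / real n + 2 * pi * of_int m) + \<i> * complex_of_real \<eta> \<and>
      0 < \<eta> \<and> \<eta> \<le> 2 * height k / real n"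
    using assms by blast
  hence "\<exists>m\<in>\<int>. \<exists>\<eta>. q = complex_of_real (2 * pi * real k / real n + 2 * pi * m) + \<i> * complex_of_real \<eta> \<and>
      0 < \<eta> \<and> \<eta> \<le> 2 * height k / real n"
    by (rule bexI [OF _ Ints_of_int])
  thus ?L by (intro bexI [OF _ mem] case_prodI)
qed

lemma comb_domain_eq: "comb_domain slits = (\<lambda>q. 2 / of_nat n * q) ` (upper_half_plane - range \<Theta>r)"
proof -
  have mem: "q \<in> comb_domain slits \<longleftrightarrow> Im q > 0 \<and> of_nat n / 2 * q \<notin> range \<Theta>r" for q
  proof (cases "Im q > 0")
    case True
    have "q \<in> comb_domain slits \<longleftrightarrow> \<not> (\<exists>(\<omega>, h)\<in>slits. \<exists>m\<in>\<int>. \<exists>\<eta>. q = complex_of_real (\<omega> + 2 * pi * m) + \<i> * complex_of_real \<eta> \<and> 0 < \<eta> \<and> \<eta> \<le> h)"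
      unfolding comb_domain_def upper_half_plane_def using True by auto
    thus ?thesis unfolding slit_iff [OF True] using True by simp
  next
    case False thus ?thesis by (auto simp: comb_domain_def upper_half_plane_def)
  qed
  show ?thesis
  proof (intro set_eqI iffI)
    fix q assume "q \<in> comb_domain slits"
    hence "of_nat n / 2 * q \<in> upper_half_plane - range \<Theta>r" "q = 2 / of_nat n * (of_nat n / 2 * q)"
      using n_pos unfolding mem by (simp_all add: upper_half_plane_def)
    thus "q \<in> (\<lambda>q. 2 / of_nat n * q) ` (upper_half_plane - range \<Theta>r)" by blast
  next
    fix q assume "q \<in> (\<lambda>q. 2 / of_nat n * q) ` (upper_half_plane - range \<Theta>r)"
    then obtain u where u: "q = 2 / of_nat n * u" "Im u > 0" "u \<notin> range \<Theta>r" by (auto simp: upper_half_plane_def)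
    have "of_nat n / 2 * q = u" using n_pos by (simp add: u)
    moreover have "Im q = 2 / n * Im u" using u(1) by (simp add: Im_divide_of_nat)
    ultimately show "q \<in> comb_domain slits" unfolding mem using u n_pos by simp
  qed
qed

end

section \<open>The comb map of an alternating polynomial\<close>

lemma comb_representation:
  assumes "alternating_poly n P t"
  obtains S \<tau> where "regular_comb_data n S" "\<tau> holomorphic_on upper_half_plane"
    "bij_betw \<tau> upper_half_plane (comb_domain S)" "continuous_on {z. Im z \<ge> 0} \<tau>"
    "\<And>z. Im z \<ge> 0 \<Longrightarrow> cos (of_nat n / 2 * \<tau> z) = trig n P z"
    "\<And>k. k < n \<Longrightarrow> \<tau> (of_real (t k)) = complex_of_real (2 * pi * real k / real n)"
proof -
  interpret alternating_poly n P t by fact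
  obtain \<Theta> where \<Theta>: "alternating_phase n P t \<Theta>" "\<And>j. j \<le> n \<Longrightarrow> \<Theta> (of_real (t j)) = of_real (pi * real j)"
    using phase_exists by blast
  interpret comb_phase n P t \<Theta>
    using \<Theta> by (simp add: comb_phase_def comb_phase_axioms_def)
  define \<tau> where "\<tau> z = 2 / of_nat n * \<Theta> z" for z
  have n0: "complex_of_nat n \<noteq> 0" using n_pos by simp
  show thesis
  proof
    show "regular_comb_data n slits" by (rule slits_regular)
    show "\<tau> holomorphic_on upper_half_plane" unfolding \<tau>_def by (intro holomorphic_intros hol)
    show "continuous_on {z. Im z \<ge> 0} \<tau>" unfolding \<tau>_def by (intro continuous_intros cont)
    have "bij_betw (\<lambda>q. 2 / of_nat n * q) (upper_half_plane - range \<Theta>r) (comb_domain slits)"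
      unfolding comb_domain_eq by (rule inj_on_imp_bij_betw) (use n0 in \<open>auto simp: inj_on_def\<close>)
    from bij_betw_trans [OF phase_bij this]
    show "bij_betw \<tau> upper_half_plane (comb_domain slits)" by (simp add: o_def \<tau>_def [abs_def])
    show "cos (of_nat n / 2 * \<tau> z) = trig n P z" if "Im z \<ge> 0" for z
      using cos_phase [OF that] n0 by (simp add: \<tau>_def)
    show "\<tau> (of_real (t k)) = complex_of_real (2 * pi * real k / real n)" if "k < n" for k
      using normalized [of k] that by (simp add: \<tau>_def)
  qed
qed

subsection \<open>Alternation\<close>

text \<open>The induction discards the part of \<open>A\<close> before the first point of
  \<open>B\<close> and exchanges the sets; too few alternations leave at most \<open>n - 2\<close>
  sign changes. The zeros are kept strictly between \<open>a0\<close> and another point of the sets,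
  so that they can serve as angles within one period.\<close>

lemma alternation_or_separation:
  fixes A B :: "real set"
  assumes "n \<ge> 1" "compact A" "compact B" "A \<inter> B = {}" "a0 \<in> A" "\<And>s. s \<in> A \<union> B \<Longrightarrow> a0 \<le> s"
  shows "(\<exists>t::nat \<Rightarrow> real. (\<forall>j<n. t j \<in> (if even j then A else B)) \<and> (\<forall>j. Suc j < n \<longrightarrow> t j < t (Suc j))) \<or>
    (\<exists>ss \<sigma>. length ss + 2 \<le> n \<and> (\<forall>a\<in>set ss. a0 < a \<and> (\<exists>s\<in>A \<union> B. a < s)) \<and>
       (\<forall>s\<in>A. 0 < \<sigma> * prod_list (map (\<lambda>a. s - a) ss)) \<and> (\<forall>s\<in>B. \<sigma> * prod_list (map (\<lambda>a. s - a) ss) < (0::real)))"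
  using assms
proof (induction n arbitrary: A B a0 rule: dec_induct)
  case base
  thus ?case by (intro disjI1 exI [of _ "\<lambda>_. a0"]) auto
next
  case (step n)
  show ?case
  proof (cases "B = {}")
    case True
    thus ?thesis using step.hyps by (intro disjI2 exI [of _ "[]"] exI [of _ 1]) auto
  next
    case False
    define b where "b = Inf B"
    have b: "b \<in> B" unfolding b_def
      by (rule closed_contains_Inf) (use False step.prems in \<open>auto intro: compact_imp_closed bounded_imp_bdd_below compact_imp_bounded\<close>)
    have bmin: "b \<le> s" if "s \<in> B" for s
      unfolding b_def by (rule cInf_lower) (use that step.prems in \<open>auto intro: bounded_imp_bdd_below compact_imp_bounded\<close>)
    have a0b: "a0 < b" using step.prems(3,4) step.prems(5) [of b] b by (metis IntI UnI2 empty_iff order_le_less)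
    define A' where "A' = A \<inter> {b..}"
    have IH: "(\<exists>t::nat \<Rightarrow> real. (\<forall>j<n. t j \<in> (if even j then B else A')) \<and> (\<forall>j. Suc j < n \<longrightarrow> t j < t (Suc j))) \<or>
      (\<exists>ss \<sigma>. length ss + 2 \<le> n \<and> (\<forall>a\<in>set ss. b < a \<and> (\<exists>s\<in>B \<union> A'. a < s)) \<and>
       (\<forall>s\<in>B. 0 < \<sigma> * prod_list (map (\<lambda>a. s - a) ss)) \<and> (\<forall>s\<in>A'. \<sigma> * prod_list (map (\<lambda>a. s - a) ss) < (0::real)))"
      by (rule step.IH) (use step.prems b bmin in \<open>auto simp: A'_def compact_Int_closed\<close>)
    thus ?thesis
    proof
      assume "\<exists>t::nat \<Rightarrow> real. (\<forall>j<n. t j \<in> (if even j then B else A')) \<and> (\<forall>j. Suc j < n \<longrightarrow> t j < t (Suc j))"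
      then obtain t :: "nat \<Rightarrow> real" where t: "\<And>j. j < n \<Longrightarrow> t j \<in> (if even j then B else A')" "\<And>j. Suc j < n \<Longrightarrow> t j < t (Suc j)"
        by blast
      define t' where "t' j = (case j of 0 \<Rightarrow> a0 | Suc i \<Rightarrow> t i)" for j
      have "t' j \<in> (if even j then A else B)" if "j < Suc n" for j
        using that t(1) [of "j - 1"] step.prems(4) by (cases j) (auto simp: t'_def A'_def split: if_splits)
      moreover have "t' j < t' (Suc j)" if "Suc j < Suc n" for j
        using that t(2) [of "j - 1"] t(1) [of 0] a0b bmin [of "t 0"] by (cases j) (auto simp: t'_def)
      ultimately show ?thesis by blast
    next
      assume "\<exists>ss \<sigma>. length ss + 2 \<le> n \<and> (\<forall>a\<in>set ss. b < a \<and> (\<exists>s\<in>B \<union> A'. a < s)) \<and>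
       (\<forall>s\<in>B. 0 < \<sigma> * prod_list (map (\<lambda>a. s - a) ss)) \<and> (\<forall>s\<in>A'. \<sigma> * prod_list (map (\<lambda>a. s - a) ss) < (0::real))"
      then obtain ss and \<sigma> :: real where ss: "length ss + 2 \<le> n" "\<And>a. a \<in> set ss \<Longrightarrow> b < a" "\<And>a. a \<in> set ss \<Longrightarrow> \<exists>s\<in>B \<union> A'. a < s"
        "\<And>s. s \<in> B \<Longrightarrow> 0 < \<sigma> * prod_list (map (\<lambda>a. s - a) ss)" "\<And>s. s \<in> A' \<Longrightarrow> \<sigma> * prod_list (map (\<lambda>a. s - a) ss) < 0"
        by blast
      define a1 where "a1 = Sup (A \<inter> {..b})"
      have cA: "compact (A \<inter> {..b})" using step.prems by (intro compact_Int_closed) auto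
      have a1: "a1 \<in> A \<inter> {..b}" unfolding a1_def
        by (rule closed_contains_Sup) (use cA step.prems a0b in \<open>auto intro: compact_imp_closed bounded_imp_bdd_above compact_imp_bounded\<close>)
      have a1max: "s \<le> a1" if "s \<in> A" "s \<le> b" for s
        unfolding a1_def by (rule cSup_upper) (use that cA in \<open>auto intro: bounded_imp_bdd_above compact_imp_bounded\<close>)
      have a1b: "a1 < b" using a1 b step.prems(3) by (metis IntD1 IntD2 IntI atMost_iff empty_iff order_le_less)
      \<comment> \<open>The new zero separates \<open>b\<close> from the last point of
        \<open>A\<close> before it.\<close>
      define c where "c = (a1 + b) / 2"
      have c: "a1 < c" "c < b" using a1b by (auto simp: c_def)
      have a01: "a0 \<le> a1" using a1 step.prems(5) by blast
      \<comment> \<open>The old zeros lie to the right of \<open>b\<close>, so to its left the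
        product keeps the sign it has at \<open>b\<close>.\<close>
      have low: "0 < \<sigma> * prod_list (map (\<lambda>a. s - a) ss)" if "s \<le> b" for s
      proof -
        have "0 < prod_list (map (\<lambda>a. s - a) us) * prod_list (map (\<lambda>a. b - a) us)" if "\<And>a. a \<in> set us \<Longrightarrow> b < a" for us
          using that
        proof (induction us)
          case (Cons u us)
          have "0 < (s - u) * (b - u)" using Cons.prems [of u] \<open>s \<le> b\<close> by (intro mult_neg_neg) auto
          moreover have "0 < prod_list (map (\<lambda>a. s - a) us) * prod_list (map (\<lambda>a. b - a) us)" using Cons by auto
          ultimately have "0 < ((s - u) * (b - u)) * (prod_list (map (\<lambda>a. s - a) us) * prod_list (map (\<lambda>a. b - a) us))" by (rule mult_pos_pos)
          thus ?case by (simp add: mult_ac)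
        qed simp
        from this [of ss] ss(2) have "0 < prod_list (map (\<lambda>a. s - a) ss) * prod_list (map (\<lambda>a. b - a) ss)" by blast
        thus ?thesis using ss(4) [OF b] by (auto simp: zero_less_mult_iff)
      qed
      show ?thesis
      \<comment> \<open>The sign of \<open>\<sigma>\<close> flips because the sets were exchanged;
        the factor \<open>s - c\<close> corrects this on the discarded part of
        \<open>A\<close>.\<close>
      proof (intro disjI2 exI [of _ "c # ss"] exI [of _ "- \<sigma>"] conjI ballI)
        show "length (c # ss) + 2 \<le> Suc n" using ss(1) by simp
        fix a assume a: "a \<in> set (c # ss)"
        show "a0 < a" using a ss(2) [of a] c a01 a0b by auto
        show "\<exists>s\<in>A \<union> B. a < s" using a ss(3) [of a] c b by (auto simp: A'_def)
      next
        fix s assume s: "s \<in> A"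
        show "0 < - \<sigma> * prod_list (map (\<lambda>a. s - a) (c # ss))"
        proof (cases "s \<le> b")
          case True
          hence "s - c < 0" using a1max [OF s] c by simp
          hence "(s - c) * (\<sigma> * prod_list (map (\<lambda>a. s - a) ss)) < 0" using low [OF True] by (rule mult_neg_pos)
          thus ?thesis by (simp add: mult_ac)
        next
          case False
          hence "s \<in> A'" "0 < s - c" using s c by (auto simp: A'_def)
          hence "(s - c) * (\<sigma> * prod_list (map (\<lambda>a. s - a) ss)) < 0" using ss(5) by (simp add: mult_pos_neg)
          thus ?thesis by (simp add: mult_ac)
        qed
      next
        fix s assume s: "s \<in> B"
        hence "0 < s - c" using bmin [OF s] c by simp
        hence "0 < (s - c) * (\<sigma> * prod_list (map (\<lambda>a. s - a) ss))" using ss(4) [OF s] by simp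
        thus "- \<sigma> * prod_list (map (\<lambda>a. s - a) (c # ss)) < 0" by (simp add: mult_ac)
      qed
    qed
  qed
qed

text \<open>Where \<open>f * g\<close> is non-negative, |f| stays below some
  \<open>\<rho> < 1\<close>, which leaves room for a small \<open>\<delta>\<close>. Elsewhere
  \<open>\<delta> * g\<close> has the sign opposite to \<open>f\<close> and is too small to leave
  (-1, 1) on the other side.\<close>

lemma perturbation_decreases_norm:
  fixes f g :: "real \<Rightarrow> real"
  assumes F: "compact F" and f: "continuous_on F f" and g: "continuous_on F g"
    and f1: "\<And>s. s \<in> F \<Longrightarrow> \<bar>f s\<bar> \<le> 1" and fg: "\<And>s. s \<in> F \<Longrightarrow> \<bar>f s\<bar> = 1 \<Longrightarrow> f s * g s < 0"
  obtains \<delta> c where "\<delta> > 0" "0 < c" "c < 1" "\<And>s. s \<in> F \<Longrightarrow> \<bar>f s + \<delta> * g s\<bar> \<le> c"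
proof -
  obtain G where G: "G > 0" "\<And>s. s \<in> F \<Longrightarrow> \<bar>g s\<bar> \<le> G"
  proof -
    have "bounded (g ` F)" using compact_imp_bounded [OF compact_continuous_image [OF g F]] .
    thus thesis using that unfolding bounded_pos by auto
  qed
  define K where "K = {s \<in> F. 0 \<le> f s * g s}"
  have cK: "compact K"
  proof -
    have "closedin (top_of_set F) (F \<inter> (\<lambda>s. f s * g s) -` {0..})"
      by (intro continuous_closedin_preimage continuous_intros f g closed_atLeast)
    moreover have "F \<inter> (\<lambda>s. f s * g s) -` {0..} = K" by (auto simp: K_def)
    ultimately show ?thesis using closedin_compact [OF F] by simp
  qed
  have "\<exists>\<rho><1. 0 \<le> \<rho> \<and> (\<forall>s\<in>K. \<bar>f s\<bar> \<le> \<rho>)"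
  proof (cases "K = {}")
    case True thus ?thesis by (intro exI [of _ 0]) auto
  next
    case False
    have "continuous_on K (\<lambda>s. \<bar>f s\<bar>)" by (intro continuous_intros continuous_on_subset [OF f]) (auto simp: K_def)
    then obtain s0 where s0: "s0 \<in> K" "\<And>s. s \<in> K \<Longrightarrow> \<bar>f s\<bar> \<le> \<bar>f s0\<bar>"
      using continuous_attains_sup [OF cK False] by blast
    have "\<bar>f s0\<bar> < 1" using f1 [of s0] fg [of s0] s0(1) by (force simp: K_def)
    thus ?thesis using s0 by (intro exI [of _ "\<bar>f s0\<bar>"]) auto
  qed
  then obtain \<rho> where \<rho>: "\<rho> < 1" "0 \<le> \<rho>" "\<And>s. s \<in> K \<Longrightarrow> \<bar>f s\<bar> \<le> \<rho>" by blast
  define \<delta> where "\<delta> = (1 - \<rho>) / (2 * G)"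
  have \<delta>: "\<delta> > 0" "\<delta> * G < 1 - \<rho>" using \<rho> G(1) by (simp_all add: \<delta>_def)
  have lt: "\<bar>f s + \<delta> * g s\<bar> < 1" if s: "s \<in> F" for s
  proof -
    have "\<bar>\<delta> * g s\<bar> \<le> \<delta> * G" using G(2) [OF s] \<delta>(1) by (simp add: abs_mult)
    hence dg: "\<bar>\<delta> * g s\<bar> < 1 - \<rho>" using \<delta>(2) by linarith
    show ?thesis
    proof (cases "s \<in> K")
      case True thus ?thesis using \<rho>(3) dg abs_triangle_ineq [of "f s" "\<delta> * g s"] by fastforce
    next
      case False
      hence "f s * g s < 0" using s by (auto simp: K_def)
      then consider "f s < 0" "\<delta> * g s > 0" | "f s > 0" "\<delta> * g s < 0" using \<delta>(1) by (auto simp: mult_less_0_iff)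
      thus ?thesis using f1 [OF s] dg \<rho>(2) by cases (simp_all add: abs_if split: if_splits)
    qed
  qed
  show thesis
  proof (cases "F = {}")
    case True thus ?thesis using that [of \<delta> "1 / 2"] \<delta> by auto
  next
    case False
    have "continuous_on F (\<lambda>s. \<bar>f s + \<delta> * g s\<bar>)" by (intro continuous_intros f g)
    then obtain s0 where s0: "s0 \<in> F" "\<And>s. s \<in> F \<Longrightarrow> \<bar>f s + \<delta> * g s\<bar> \<le> \<bar>f s0 + \<delta> * g s0\<bar>"
      using continuous_attains_sup [OF F False] by blast
    \<comment> \<open>The maximum with 1/2 keeps \<open>c\<close> positive, as later a division by
      it takes place.\<close>
    show ?thesis
      by (rule that [OF \<delta>(1), of "max (1 / 2) \<bar>f s0 + \<delta> * g s0\<bar>"]) (use lt [OF s0(1)] s0(2) in \<open>auto simp: le_max_iff_disj\<close>)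
  qed
qed

subsection \<open>Products of sines as polynomials\<close>

text \<open>The linear polynomial with root \<open>cis a\<close>, scaled so that
  \<open>trig 1\<close> turns it into the sine of half the angle from \<open>a\<close>.\<close>

definition sine_poly :: "real \<Rightarrow> complex poly" where
  "sine_poly a = smult (exp (- (\<i> * of_real a / 2)) / (2 * \<i>)) [:- cis a, 1:]"

lemma trig_mult: "trig (m + n) (P * Q) z = trig m P z * trig n Q z"
proof -
  have "exp (- (\<i> * of_nat (m + n) * z / 2)) = exp (- (\<i> * of_nat m * z / 2)) * exp (- (\<i> * of_nat n * z / 2))"
    unfolding exp_add [symmetric] by (rule arg_cong [of _ _ exp]) (simp add: field_simps)
  thus ?thesis by (simp add: trig_def)
qed

lemma trig_sine_poly: "trig 1 (sine_poly a) (of_real s) = of_real (sin ((s - a) / 2))"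
proof -
  define A where "A = exp (\<i> * of_real a / 2)"
  define Z where "Z = exp (\<i> * of_real s / 2)"
  have nz: "A \<noteq> 0" "Z \<noteq> 0" by (simp_all add: A_def Z_def)
  have c: "cis a = A * A" "exp (\<i> * of_real s) = Z * Z" 
    unfolding A_def Z_def cis_conv_exp by (simp_all flip: exp_add)
  have "sin (complex_of_real ((s - a) / 2)) = (Z / A - A / Z) / (2 * \<i>)"
    unfolding sin_exp_eq A_def Z_def by (simp add: diff_divide_distrib right_diff_distrib exp_diff)
  moreover have "trig 1 (sine_poly a) (of_real s) = inverse Z * (inverse A / (2 * \<i>) * (Z * Z - A * A))"
  proof -
    have "poly (sine_poly a) (Z * Z) = inverse A / (2 * \<i>) * (Z * Z - A * A)"
      unfolding sine_poly_def c(1) poly_smult by (simp add: exp_minus A_def)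
    thus ?thesis unfolding trig_def c(2) by (simp add: exp_minus Z_def)
  qed
  moreover have "inverse Z * (inverse A / (2 * \<i>) * (Z * Z - A * A)) = (Z / A - A / Z) / (2 * \<i>)"
    using nz by (simp add: field_simps)
  ultimately show ?thesis by (metis sin_of_real)
qed

definition sine_prod :: "real list \<Rightarrow> complex poly" where
  "sine_prod as = prod_list (map sine_poly as)"

lemma trig_sine_prod:
  "trig (length as) (sine_prod as) (of_real s) = of_real (prod_list (map (\<lambda>a. sin ((s - a) / 2)) as))"
proof (induction as)
  case Nil thus ?case by (simp add: sine_prod_def trig_def)
next
  case (Cons a as)
  thus ?case using trig_mult [of 1 "length as" "sine_poly a" "sine_prod as" "of_real s"] 
    by (simp add: sine_prod_def trig_sine_poly [unfolded One_nat_def])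
qed

lemma degree_sine_prod: "degree (sine_prod as) \<le> length as"
proof (induction as)
  case (Cons a as)
  have "degree (sine_poly a) \<le> 1" by (simp add: sine_poly_def)
  thus ?case using Cons degree_mult_le [of "sine_poly a" "sine_prod as"] by (simp add: sine_prod_def)
qed (simp add: sine_prod_def)

lemma sine_prod_double_root:
  assumes "as = x # x # bs"
  shows "poly (sine_prod as) (cis x) = 0" "poly (pderiv (sine_prod as)) (cis x) = 0"
proof -
  have "poly (sine_poly x) (cis x) = 0" by (simp add: sine_poly_def)
  thus "poly (sine_prod as) (cis x) = 0" "poly (pderiv (sine_prod as)) (cis x) = 0"
    by (simp_all add: assms sine_prod_def pderiv_mult)
qed

lemma sgn_sin_half: "\<bar>u\<bar> < 2 * pi \<Longrightarrow> sgn (sin (u / 2)) = sgn (u::real)"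
  using sin_gt_zero [of "u / 2"] sin_gt_zero [of "- u / 2"] by (cases u "0::real" rule: linorder_cases) auto

text \<open>This turns an algebraic separating polynomial into a trigonometric one with the same
  signs within one period.\<close>

lemma sgn_sine_prod:
  assumes "\<And>a. a \<in> set as \<Longrightarrow> \<bar>s - a\<bar> < 2 * pi"
  shows "sgn (prod_list (map (\<lambda>a. sin ((s - a) / 2)) as)) = sgn (prod_list (map (\<lambda>a. s - a) as))"
  using assms
proof (induction as)
  case (Cons a as)
  thus ?case by (simp add: sgn_mult sgn_sin_half)
qed simp

subsection \<open>Symmetrisation\<close>

text \<open>The polynomial w^n conj(P(1 / conj w)). It makes the real part of
  \<open>trig n P\<close> on the real line again of the form \<open>trig n\<close>.\<close>

definition conj_reciprocal :: "nat \<Rightarrow> complex poly \<Rightarrow> complex poly" where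
  "conj_reciprocal n P = (\<Sum>k\<le>n. monom (cnj (coeff P (n - k))) k)"

lemma degree_conj_reciprocal: "degree (conj_reciprocal n P) \<le> n"
  unfolding conj_reciprocal_def
  by (rule degree_sum_le) (auto intro: order_trans [OF degree_monom_le])

lemma trig_conj_reciprocal:
  assumes "degree P \<le> n"
  shows "trig n (conj_reciprocal n P) (of_real s) = cnj (trig n P (of_real s))"
proof -
  define w where "w = cis s"
  have w1: "cnj w * w = 1" by (simp add: w_def cis_cnj cis_mult)
  have P: "poly P w = (\<Sum>k\<le>n. coeff P k * w ^ k)"
    by (subst poly_as_sum_of_monoms' [OF assms, symmetric]) (simp add: poly_sum poly_monom)
  have "poly (conj_reciprocal n P) w = (\<Sum>k\<le>n. cnj (coeff P (n - k)) * w ^ k)"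
    by (simp add: conj_reciprocal_def poly_sum poly_monom)
  also have "\<dots> = (\<Sum>k\<le>n. cnj (coeff P k) * w ^ (n - k))"
    by (rule sum.reindex_bij_witness [of _ "\<lambda>k. n - k" "\<lambda>k. n - k"]) auto
  also have "\<dots> = (\<Sum>k\<le>n. w ^ n * cnj (coeff P k * w ^ k))"
  proof (rule sum.cong [OF refl])
    fix k assume "k \<in> {..n}"
    hence "w ^ n = w ^ (n - k) * w ^ k" by (simp flip: power_add)
    hence "w ^ n * cnj (w ^ k) = w ^ (n - k) * (cnj w * w) ^ k" by (simp add: power_mult_distrib mult_ac)
    hence "w ^ n * cnj (w ^ k) = w ^ (n - k)" unfolding w1 by simp
    moreover have "w ^ n * cnj (coeff P k * w ^ k) = cnj (coeff P k) * (w ^ n * cnj (w ^ k))"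
      by (simp add: mult_ac)
    ultimately show "cnj (coeff P k) * w ^ (n - k) = w ^ n * cnj (coeff P k * w ^ k)" by simp
  qed
  also have "\<dots> = w ^ n * cnj (poly P w)" by (simp add: P sum_distrib_left cnj_sum)
  finally have star: "poly (conj_reciprocal n P) w = w ^ n * cnj (poly P w)" .
  have ew: "exp (\<i> * of_real s) = w" by (simp add: w_def cis_conv_exp)
  have wn: "w ^ n = exp (\<i> * of_nat n * of_real s / 2) * exp (\<i> * of_nat n * of_real s / 2)"
    unfolding w_def cis_conv_exp exp_of_nat_mult [symmetric] exp_add [symmetric]
    by (rule arg_cong [of _ _ exp]) (simp add: field_simps)
  have "cnj (exp (- (\<i> * of_nat n * of_real s / 2))) = exp (\<i> * of_nat n * of_real s / 2)"
    by (simp add: exp_cnj)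
  thus ?thesis unfolding trig_def ew star wn by (simp add: exp_minus)
qed

subsection \<open>Existence of extremal polynomials\<close>

text \<open>Lagrange interpolation at the \<open>n + 1\<close> nodes \<open>w 0\<close> to
  \<open>w n\<close>.\<close>

lemma interpolation_basis:
  fixes w :: "nat \<Rightarrow> complex"
  assumes "inj w"
  obtains L where "\<And>j. j \<le> n \<Longrightarrow> degree (L j) \<le> n"
    "\<And>Q. degree Q \<le> n \<Longrightarrow> Q = (\<Sum>j\<le>n. smult (poly Q (w j)) (L j))"
proof -
  define N where "N j = (\<Prod>i\<in>{..n} - {j}. [:- w i, 1:])" for j
  define L where "L j = smult (inverse (poly (N j) (w j))) (N j)" for j
  have dN: "degree (N j) \<le> n" if "j \<le> n" for j
  proof -
    have "degree (N j) \<le> (\<Sum>i\<in>{..n} - {j}. degree [:- w i, 1:])"       unfolding N_def using degree_prod_sum_le [of "{..n} - {j}" "\<lambda>i. [:- w i, 1:]"] by (simp add: o_def)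
    also have "\<dots> = n" using that by simp
    finally show ?thesis .
  qed
  have Lij: "poly (L j) (w i) = (if i = j then 1 else 0)" if "i \<le> n" "j \<le> n" for i j
  proof (cases "i = j")
    case True
    have "poly (N j) (w j) \<noteq> 0" using assms by (auto simp: N_def poly_prod inj_eq)
    thus ?thesis using True by (simp add: L_def)
  next
    case False
    have "poly (N j) (w i) = 0" using False that by (auto simp: N_def poly_prod)
    thus ?thesis using False by (simp add: L_def)
  qed
  have dL: "degree (L j) \<le> n" if "j \<le> n" for j unfolding L_def using dN [OF that] degree_smult_le order_trans by blast
  have "Q = (\<Sum>j\<le>n. smult (poly Q (w j)) (L j))" if "degree Q \<le> n" for Q
  proof (rule poly_eqI_degree [of "w ` {..n}"])
    have card: "card (w ` {..n}) = Suc n" using assms by (simp add: card_image inj_on_subset [of w UNIV])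
    show "degree Q < card (w ` {..n})" using that card by simp
    have "degree (\<Sum>j\<le>n. smult (poly Q (w j)) (L j)) \<le> n"
      by (rule degree_sum_le) (auto intro: dL)
    thus "degree (\<Sum>j\<le>n. smult (poly Q (w j)) (L j)) < card (w ` {..n})" using card by simp
    fix y assume "y \<in> w ` {..n}"
    then obtain i where i: "i \<le> n" "y = w i" by blast
    have "poly (\<Sum>j\<le>n. smult (poly Q (w j)) (L j)) y = (\<Sum>j\<le>n. if i = j then poly Q (w j) else 0)"
      unfolding poly_sum i(2) by (rule sum.cong) (use i Lij in auto)
    also have "\<dots> = poly Q y" using i by (simp add: sum.delta')
    finally show "poly Q y = poly (\<Sum>j\<le>n. smult (poly Q (w j)) (L j)) y" by simp
  qed
  thus thesis using that dL by blast
qed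

text \<open>Values at \<open>n + 1\<close> points of E are coordinates for polynomials, and on
  \<open>Pn n E\<close> they lie in the closed unit disc. The admissible coordinates form a closed
  subset of a product of discs, compact by Tychonoff's theorem.\<close>

lemma extremal_exists:
  assumes "infinite E"
  obtains P where "P \<in> Pn n E" "poly P \<zeta> = 0"
    "\<And>Q. Q \<in> Pn n E \<Longrightarrow> poly Q \<zeta> = 0 \<Longrightarrow> norm (poly (pderiv Q) \<zeta>) \<le> norm (poly (pderiv P) \<zeta>)"
proof -
  obtain w :: "nat \<Rightarrow> complex" where w: "inj w" "range w \<subseteq> E" using infinite_countable_subset [OF assms] by blast
  obtain L where L: "\<And>j. j \<le> n \<Longrightarrow> degree (L j) \<le> n" 
    "\<And>Q. degree Q \<le> n \<Longrightarrow> Q = (\<Sum>j\<le>n. smult (poly Q (w j)) (L j))"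
    using interpolation_basis [OF w(1), of n] by blast
  define comb where "comb v = (\<Sum>j\<le>n. smult (v j) (L j))" for v :: "nat \<Rightarrow> complex"
  have pc: "poly (comb v) y = (\<Sum>j\<le>n. v j * poly (L j) y)" for v y by (simp add: comb_def poly_sum)
  have pd: "poly (pderiv (comb v)) y = (\<Sum>j\<le>n. v j * poly (pderiv (L j)) y)" for v y
    unfolding comb_def by (induction n) (simp_all add: pderiv_add pderiv_smult)
  have dc: "degree (comb v) \<le> n" for v
    unfolding comb_def by (rule degree_sum_le) (auto intro: L(1))
  define K where "K = {v. \<forall>j. v j \<in> cball (0::complex) 1} \<inter> {v. poly (comb v) \<zeta> = 0} \<inter> (\<Inter>y\<in>E. {v. norm (poly (comb v) y) \<le> 1})"
  have coord: "continuous_on UNIV (\<lambda>v::nat \<Rightarrow> complex. v j)" for j by (rule continuous_on_product_coordinates)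
  have "{v. \<forall>j. v j \<in> cball (0::complex) 1} = PiE (UNIV :: nat set) (\<lambda>_. cball 0 1)" by (auto simp: PiE_def)
  moreover have "compactin (product_topology (\<lambda>_. euclidean) (UNIV :: nat set)) (PiE UNIV (\<lambda>_. cball (0::complex) 1))"
    unfolding compactin_PiE by simp
  ultimately have cpt: "compact {v::nat \<Rightarrow> complex. \<forall>j. v j \<in> cball 0 1}"
    by (simp add: euclidean_product_topology)
  have cK: "compact K"
    unfolding K_def pc
    by (intro compact_Int_closed cpt closed_INT ballI closed_Collect_eq closed_Collect_le continuous_intros coord)
  have "(\<lambda>_. 0) \<in> K" by (simp add: K_def pc)
  hence ne: "K \<noteq> {}" by blast
  have "continuous_on K (\<lambda>v. norm (poly (pderiv (comb v)) \<zeta>))"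
    unfolding pd by (intro continuous_intros continuous_on_subset [OF coord]) auto
  then obtain v where v: "v \<in> K" "\<And>u. u \<in> K \<Longrightarrow> norm (poly (pderiv (comb u)) \<zeta>) \<le> norm (poly (pderiv (comb v)) \<zeta>)"
    using continuous_attains_sup [OF cK ne] by blast
  show thesis
  proof (rule that [of "comb v"])
    show "comb v \<in> Pn n E" "poly (comb v) \<zeta> = 0" using v(1) dc by (auto simp: K_def Pn_def)
    fix Q assume Q: "Q \<in> Pn n E" "poly Q \<zeta> = 0"
    \<comment> \<open>The value 0 beyond \<open>n\<close> keeps \<open>u\<close> in the product of
      discs.\<close>
    define u where "u j = (if j \<le> n then poly Q (w j) else 0)" for j
    have "comb u = Q" using L(2) [of Q] Q(1) by (simp add: comb_def u_def Pn_def)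
    moreover from this have "u \<in> K" using Q w(2) by (auto simp: K_def Pn_def u_def)
    ultimately show "norm (poly (pderiv Q) \<zeta>) \<le> norm (poly (pderiv (comb v)) \<zeta>)" using v(2) by blast
  qed
qed

text \<open>The root of \<open>P\<close> removes the derivative of the exponential prefactor, so the
  remaining factors of \<open>poly (pderiv P) (cis x)\<close> are unimodular.\<close>

lemma trig_vector_derivative:
  assumes "poly P (cis x) = 0"
  shows "((\<lambda>s. trig n P (of_real s)) has_vector_derivative
    exp (- (\<i> * of_nat n * of_real x / 2)) * (\<i> * cis x) * poly (pderiv P) (cis x)) (at x)"
proof -
  have c: "exp (\<i> * of_real x) = cis x" by (simp add: cis_conv_exp)
  have "(trig n P has_field_derivative 
    exp (- (\<i> * of_nat n * of_real x / 2)) * (- (\<i> * of_nat n / 2)) * poly P (exp (\<i> * of_real x)) + 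
    exp (- (\<i> * of_nat n * of_real x / 2)) * (poly (pderiv P) (exp (\<i> * of_real x)) * (exp (\<i> * of_real x) * \<i>))) (at (of_real x))"
    unfolding trig_def [abs_def]
    by (rule derivative_eq_intros DERIV_chain2 [OF poly_DERIV] refl | simp)+
  hence "(trig n P has_field_derivative 
    exp (- (\<i> * of_nat n * of_real x / 2)) * (\<i> * cis x) * poly (pderiv P) (cis x)) (at (of_real x))"
    unfolding c by (simp add: assms mult_ac)
  thus ?thesis by (rule has_vector_derivative_real_field)
qed

lemma real_extremal_exists:
  assumes E: "E \<subseteq> sphere 0 1" "infinite E"
  obtains P where "P \<in> Pn n E" "poly P (cis x) = 0" "\<And>s::real. trig n P (of_real s) \<in> \<real>"
    "\<And>Q. Q \<in> Pn n E \<Longrightarrow> poly Q (cis x) = 0 \<Longrightarrow> norm (poly (pderiv Q) (cis x)) \<le> norm (poly (pderiv P) (cis x))"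
proof -
  obtain P where P: "P \<in> Pn n E" "poly P (cis x) = 0"
    "\<And>Q. Q \<in> Pn n E \<Longrightarrow> poly Q (cis x) = 0 \<Longrightarrow> norm (poly (pderiv Q) (cis x)) \<le> norm (poly (pderiv P) (cis x))"
    using extremal_exists [OF E(2), of n "cis x"] by blast
  define e where "e = exp (- (\<i> * of_nat n * of_real x / 2)) * (\<i> * cis x)"
  have e1: "norm e = 1" by (simp add: e_def norm_mult)
  define D where "D = e * poly (pderiv P) (cis x)"
  \<comment> \<open>This rotation makes the derivative at \<open>x\<close> real and non-negative;
    otherwise passing to the real part could diminish it.\<close>
  obtain \<mu> where \<mu>: "norm \<mu> = 1" "\<mu> * D = of_real (norm D)"
  proof (cases "D = 0")
    case True thus thesis using that [of 1] by simp
  next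
    case False
    hence "inverse (sgn D) * D = of_real (norm D)" by (simp add: sgn_eq field_simps)
    thus thesis using that [of "inverse (sgn D)"] False by (simp add: norm_inverse norm_sgn)
  qed
  define Q where "Q = smult \<mu> P"
  have Q: "degree Q \<le> n" "poly Q (cis x) = 0" using P(1,2) by (auto simp: Q_def Pn_def intro: order_trans [OF degree_smult_le])
  have QE: "norm (poly Q w) \<le> 1" if "w \<in> E" for w using P(1) that by (simp add: Q_def Pn_def norm_mult \<mu>)
  define R where "R = smult (1 / 2) (Q + conj_reciprocal n Q)"
  have trigR: "trig n R (of_real s) = of_real (Re (trig n Q (of_real s)))" for s
    unfolding R_def trig_smult trig_add trig_conj_reciprocal [OF Q(1)] complex_add_cnj by simp
  have degR: "degree R \<le> n" unfolding R_def
    by (intro order_trans [OF degree_smult_le] degree_add_le Q degree_conj_reciprocal)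
  have RE: "norm (poly R w) \<le> 1" if "w \<in> E" for w
  proof -
    have "norm w = 1" using that E by auto
    then obtain s where s: "w = cis s" by (metis Arg_eq Arg_exp cis_conv_exp mult_1 norm_zero of_real_1 zero_neq_one)
    have "norm (poly R w) = norm (trig n R (of_real s))" by (simp add: s norm_trig_of_real)
    also have "\<dots> \<le> norm (trig n Q (of_real s))" unfolding trigR norm_of_real by (rule abs_Re_le_cmod)
    also have "\<dots> = norm (poly Q w)" by (simp add: s norm_trig_of_real)
    finally show ?thesis using QE [OF that] by simp
  qed
  have "norm (trig n R (of_real x)) = 0" unfolding trigR using norm_trig_of_real [of n Q x] Q(2) by simp
  hence R0: "poly R (cis x) = 0" by (simp add: norm_trig_of_real)
  have "((\<lambda>s. trig n Q (of_real s)) has_vector_derivative of_real (norm D)) (at x)"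
    using trig_vector_derivative [OF Q(2), of n] \<mu>(2) by (simp add: Q_def pderiv_smult D_def e_def mult_ac)
  hence "((\<lambda>s. complex_of_real (Re (trig n Q (of_real s)))) has_vector_derivative of_real (Re (of_real (norm D)))) (at x)"
    by (intro has_vector_derivative_of_real has_field_derivative_Re)
  hence "((\<lambda>s. trig n R (of_real s)) has_vector_derivative of_real (norm D)) (at x)" by (simp add: trigR)
  from vector_derivative_unique_at [OF this trig_vector_derivative [OF R0, of n]]
  have "of_real (norm D) = e * poly (pderiv R) (cis x)" by (simp add: e_def)
  hence "norm (complex_of_real (norm D)) = norm (e * poly (pderiv R) (cis x))" by simp
  hence "norm D = norm (poly (pderiv R) (cis x))" by (simp add: norm_mult e1)
  hence nR: "norm (poly (pderiv R) (cis x)) = norm (poly (pderiv P) (cis x))" by (simp add: D_def norm_mult e1)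
  show thesis
    by (rule that [of R]) (use degR RE R0 trigR nR P(3) in \<open>auto simp: Pn_def\<close>)
qed

section \<open>Alternation of extremal polynomials\<close>

lemma norm_1_eq_cis:
  assumes "norm w = 1" obtains s where "w = cis s" "x \<le> s" "s < x + 2 * pi"
proof -
  obtain r where r: "w = cis r" using assms by (metis Arg_eq cis_conv_exp mult_1 norm_zero of_real_1 zero_neq_one)
  obtain s and m :: int where s: "x \<le> s" "s < x + 2 * pi" "r = s + 2 * pi * of_int m"
    by (rule shift_mod_2pi)
  have "w = cis s" unfolding r cis_eq_iff_int using s(3) by blast
  thus thesis using that s by blast
qed

lemma finite_arc_union_compact:
  assumes "finite_arc_union E" shows "compact E" "infinite E"
proof -
  obtain m :: nat and a b where ab: "m \<ge> 1" "\<And>j. j < m \<Longrightarrow> a j < b j \<and> b j - a j < 2 * pi" 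
    "E = (\<Union>j<m. circ_arc (a j) (b j))"
    using assms unfolding finite_arc_union_def by blast
  have img: "circ_arc c d = cis ` {c..d}" for c d by (auto simp: circ_arc_def)
  show "compact E" unfolding ab(3) img
    by (intro compact_UN compact_continuous_image continuous_intros) auto
  have "inj_on cis {a 0..b 0}"
    by (rule inj_onI, erule cis_inj_near) (use ab(1,2) in force)
  moreover have "infinite {a 0..b 0}" using ab(1,2) by (simp add: infinite_Icc)
  ultimately have "infinite (circ_arc (a 0) (b 0))" unfolding img by (simp add: finite_image_iff)
  moreover have "circ_arc (a 0) (b 0) \<subseteq> E" using ab(1,3) by auto
  ultimately show "infinite E" using finite_subset by blast
qed

lemma extremal_alternates:
  assumes E: "compact E" "E \<subseteq> sphere 0 1" "cis x \<notin> E" and n: "n \<ge> 1"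
    and P: "P \<in> Pn n E" "poly P (cis x) = 0" "\<And>s::real. trig n P (of_real s) \<in> \<real>"
    and extr: "\<And>Q. Q \<in> Pn n E \<Longrightarrow> poly Q (cis x) = 0 \<Longrightarrow> norm (poly (pderiv Q) (cis x)) \<le> norm (poly (pderiv P) (cis x))"
  obtains t :: "nat \<Rightarrow> real" and \<epsilon> :: real where "\<epsilon> = 1 \<or> \<epsilon> = -1"
    "\<And>j. j < n \<Longrightarrow> x < t j \<and> t j < x + 2 * pi \<and> cis (t j) \<in> E \<and> trig n P (of_real (t j)) = of_real (\<epsilon> * (-1) ^ j)"
    "\<And>j. Suc j < n \<Longrightarrow> t j < t (Suc j)"
proof -
  \<comment> \<open>Both ends of the window represent \<open>cis x\<close>, which is outside E, so
    \<open>F\<close> lies in the open period.\<close>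
  define F where "F = {x..x + 2 * pi} \<inter> cis -` E"
  have "compact F" unfolding F_def
    by (intro compact_Int_closed compact_Icc closed_vimage [OF compact_imp_closed [OF E(1)]] continuous_intros)
  have F: "x < s" "s < x + 2 * pi" "cis s \<in> E" if "s \<in> F" for s
  proof -
    have s: "x \<le> s" "s \<le> x + 2 * pi" "cis s \<in> E" using that by (auto simp: F_def)
    have "cis (x + 2 * pi) = cis x" unfolding cis_eq_iff_int by (rule exI [of _ 1]) simp
    hence "s \<noteq> x" "s \<noteq> x + 2 * pi" using s(3) E(3) by auto
    thus "x < s" "s < x + 2 * pi" "cis s \<in> E" using s by auto
  qed
  have EF: "\<exists>s\<in>F. w = cis s" if "w \<in> E" for w
  proof -
    have "norm w = 1" using that E(2) by auto
    then obtain s where "w = cis s" "x \<le> s" "s < x + 2 * pi" by (rule norm_1_eq_cis)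
    thus ?thesis using that by (intro bexI [of _ s]) (auto simp: F_def)
  qed
  define f where "f s = Re (trig n P (of_real s))" for s
  have f: "trig n P (of_real s) = of_real (f s)" for s using P(3) [of s] by (simp add: f_def)
  have f1: "\<bar>f s\<bar> \<le> 1" if "s \<in> F" for s
    using P(1) F(3) [OF that] norm_trig_of_real [of n P s] by (simp add: Pn_def f)
  have contf: "continuous_on A f" for A
    unfolding f_def by (intro continuous_intros continuous_on_compose2 [OF trig_continuous [of UNIV]]) auto
  \<comment> \<open>Half of w - cis x is a competitor with derivative 1/2. A positive extremal
    derivative is what rescaling will contradict.\<close>
  have pos: "norm (poly (pderiv P) (cis x)) > 0"
  proof -
    let ?Q = "smult (1 / 2) [:- cis x, 1:]"
    have "norm (poly ?Q w) \<le> 1" if "w \<in> E" for w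
    proof -
      have "norm w = 1" using that E(2) by auto
      hence "norm (w - cis x) \<le> 2" using norm_triangle_ineq4 [of w "cis x"] by simp
      hence "norm ((w - cis x) / 2) \<le> 1" by (simp only: norm_divide) simp
      moreover have "poly ?Q w = (w - cis x) / 2" by (simp add: diff_divide_distrib)
      ultimately show ?thesis by (simp only:)
    qed
    hence "?Q \<in> Pn n E" using n by (simp add: Pn_def)
    from extr [OF this] have "norm (poly (pderiv ?Q) (cis x)) \<le> norm (poly (pderiv P) (cis x))" by simp
    moreover have "norm (poly (pderiv ?Q) (cis x)) = 1 / 2" unfolding pderiv_smult by (simp add: pderiv_pCons)
    ultimately show ?thesis by linarith
  qed
  \<comment> \<open>The double root of \<open>D\<close> preserves the derivative at
    \<open>cis x\<close>, and division by \<open>c < 1\<close> then enlarges it.\<close>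
  have no_descent: False
    if D: "degree D \<le> n" "poly D (cis x) = 0" "poly (pderiv D) (cis x) = 0" "\<And>s. trig n D (of_real s) = of_real (g s)"
      and fg: "\<And>s. s \<in> F \<Longrightarrow> \<bar>f s\<bar> = 1 \<Longrightarrow> f s * g s < 0" for D g
  proof -
    have g: "g s = Re (trig n D (of_real s))" for s by (simp add: D(4))
    have contg: "continuous_on F g"
      unfolding g by (intro continuous_intros continuous_on_compose2 [OF trig_continuous [of UNIV]]) auto
    obtain \<delta> c where \<delta>: "\<delta> > 0" "0 < c" "c < 1" "\<And>s. s \<in> F \<Longrightarrow> \<bar>f s + \<delta> * g s\<bar> \<le> c"
      using perturbation_decreases_norm [OF \<open>compact F\<close> contf contg f1 fg] by blast
    define Q where "Q = smult (of_real (1 / c)) (P + smult (of_real \<delta>) D)"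
    have "norm (poly Q w) \<le> 1" if w: "w \<in> E" for w
    proof -
      obtain s where s: "s \<in> F" "w = cis s" using EF [OF w] by blast
      have "trig n Q (of_real s) = of_real ((f s + \<delta> * g s) / c)" unfolding Q_def trig_smult trig_add f D(4) by simp
      hence "norm (poly Q w) = \<bar>(f s + \<delta> * g s) / c\<bar>" unfolding s(2) norm_trig_of_real [of n Q, symmetric] by (simp only: norm_of_real)
      thus ?thesis using \<delta>(4) [OF s(1)] \<delta>(2) by simp
    qed
    moreover have "degree Q \<le> n" unfolding Q_def
      using P(1) D(1) by (auto simp: Pn_def intro!: order_trans [OF degree_smult_le] degree_add_le)
    ultimately have "Q \<in> Pn n E" by (simp add: Pn_def)
    moreover have "poly Q (cis x) = 0" using P(2) D(2) by (simp add: Q_def)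
    ultimately have "norm (poly (pderiv Q) (cis x)) \<le> norm (poly (pderiv P) (cis x))" by (rule extr)
    moreover have "poly (pderiv Q) (cis x) = of_real (1 / c) * poly (pderiv P) (cis x)"
      by (simp add: Q_def pderiv_smult pderiv_add D(3))
    ultimately have "(1 / c) * norm (poly (pderiv P) (cis x)) \<le> 1 * norm (poly (pderiv P) (cis x))"
      using \<delta>(2) by (simp add: norm_mult norm_divide)
    hence "1 / c \<le> 1" using pos by (simp only: mult_le_cancel_right)
    thus False using \<delta>(2,3) by simp
  qed
  define Z where "Z \<epsilon> = {s \<in> F. f s = \<epsilon>}" for \<epsilon>
  have cZ: "compact (Z \<epsilon>)" for \<epsilon>
  proof -
    have "Z \<epsilon> = F \<inter> f -` {\<epsilon>}" by (auto simp: Z_def)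
    thus ?thesis using compact_Int_closed [OF \<open>compact F\<close> closed_vimage [OF closed_singleton contf]] by simp
  qed
  have fZ: "s \<in> Z 1 \<union> Z (-1)" if "s \<in> F" "\<bar>f s\<bar> = 1" for s using that by (auto simp: Z_def abs_if split: if_splits)
  \<comment> \<open>With no extremal points the zero perturbation qualifies vacuously:
    \<open>P\<close> could simply be enlarged.\<close>
  have "Z 1 \<union> Z (-1) \<noteq> {}"
  proof
    assume "Z 1 \<union> Z (-1) = {}"
    hence "\<And>s. s \<in> F \<Longrightarrow> \<bar>f s\<bar> \<noteq> 1" using fZ by blast
    thus False using no_descent [of 0 "\<lambda>_. 0"] by (simp add: trig_def)
  qed
  define a0 where "a0 = Inf (Z 1 \<union> Z (-1))"
  have cZZ: "compact (Z 1 \<union> Z (-1))" by (intro compact_Un cZ)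
  have a0: "a0 \<in> Z 1 \<union> Z (-1)" unfolding a0_def
    by (intro closed_contains_Inf \<open>Z 1 \<union> Z (-1) \<noteq> {}\<close> bounded_imp_bdd_below compact_imp_bounded compact_imp_closed cZZ)
  have a0min: "a0 \<le> s" if "s \<in> Z 1 \<union> Z (-1)" for s
    unfolding a0_def by (intro cInf_lower that bounded_imp_bdd_below compact_imp_bounded cZZ)
  obtain \<epsilon> where \<epsilon>: "\<epsilon> = 1 \<or> \<epsilon> = -1" "a0 \<in> Z \<epsilon>" using a0 by blast
  have ZZ: "Z \<epsilon> \<union> Z (- \<epsilon>) = Z 1 \<union> Z (-1)" using \<epsilon>(1) by auto
  have "(\<exists>t::nat \<Rightarrow> real. (\<forall>j<n. t j \<in> (if even j then Z \<epsilon> else Z (- \<epsilon>))) \<and> (\<forall>j. Suc j < n \<longrightarrow> t j < t (Suc j))) \<or>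
    (\<exists>ss \<sigma>. length ss + 2 \<le> n \<and> (\<forall>a\<in>set ss. a0 < a \<and> (\<exists>s\<in>Z \<epsilon> \<union> Z (- \<epsilon>). a < s)) \<and>
       (\<forall>s\<in>Z \<epsilon>. 0 < \<sigma> * prod_list (map (\<lambda>a. s - a) ss)) \<and> (\<forall>s\<in>Z (- \<epsilon>). \<sigma> * prod_list (map (\<lambda>a. s - a) ss) < (0::real)))"
  proof (rule alternation_or_separation [OF n cZ cZ _ \<epsilon>(2)])
    show "Z \<epsilon> \<inter> Z (- \<epsilon>) = {}" using \<epsilon>(1) by (auto simp: Z_def)
    show "a0 \<le> s" if "s \<in> Z \<epsilon> \<union> Z (- \<epsilon>)" for s using that unfolding ZZ by (rule a0min)
  qed
  thus thesis
  proof
    assume "\<exists>t::nat \<Rightarrow> real. (\<forall>j<n. t j \<in> (if even j then Z \<epsilon> else Z (- \<epsilon>))) \<and> (\<forall>j. Suc j < n \<longrightarrow> t j < t (Suc j))"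
    then obtain t :: "nat \<Rightarrow> real" where t: "\<And>j. j < n \<Longrightarrow> t j \<in> (if even j then Z \<epsilon> else Z (- \<epsilon>))" "\<And>j. Suc j < n \<Longrightarrow> t j < t (Suc j)"
      by blast
    have "x < t j \<and> t j < x + 2 * pi \<and> cis (t j) \<in> E \<and> trig n P (of_real (t j)) = of_real (\<epsilon> * (-1) ^ j)" if "j < n" for j
    proof -
      have "t j \<in> F" "f (t j) = \<epsilon> * (-1) ^ j" using t(1) [OF that] by (auto simp: Z_def split: if_splits)
      thus ?thesis using F [of "t j"] f [of "t j"] by simp
    qed
    thus thesis using that [OF \<epsilon>(1)] t(2) by blast
  next
    assume "\<exists>ss \<sigma>. length ss + 2 \<le> n \<and> (\<forall>a\<in>set ss. a0 < a \<and> (\<exists>s\<in>Z \<epsilon> \<union> Z (- \<epsilon>). a < s)) \<and>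
       (\<forall>s\<in>Z \<epsilon>. 0 < \<sigma> * prod_list (map (\<lambda>a. s - a) ss)) \<and> (\<forall>s\<in>Z (- \<epsilon>). \<sigma> * prod_list (map (\<lambda>a. s - a) ss) < (0::real))"
    then obtain ss and \<sigma> :: real where ss: "length ss + 2 \<le> n" "\<And>a. a \<in> set ss \<Longrightarrow> a0 < a" "\<And>a. a \<in> set ss \<Longrightarrow> \<exists>s\<in>Z \<epsilon> \<union> Z (- \<epsilon>). a < s"
      "\<And>s. s \<in> Z \<epsilon> \<Longrightarrow> 0 < \<sigma> * prod_list (map (\<lambda>a. s - a) ss)" "\<And>s. s \<in> Z (- \<epsilon>) \<Longrightarrow> \<sigma> * prod_list (map (\<lambda>a. s - a) ss) < 0"
      by blast
    \<comment> \<open>Copies of \<open>x\<close>, at least two, give the double root and fill up to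
      the \<open>n\<close> factors that \<open>trig n\<close> requires. Their sines are positive on
      \<open>F\<close>.\<close>
    define as where "as = replicate (n - length ss) x @ ss"
    have len: "length as = n" using ss(1) by (simp add: as_def)
    define r where "r = n - length ss - 2"
    have r: "n - length ss = Suc (Suc r)" using ss(1) by (simp add: r_def)
    have as2: "as = x # x # (replicate r x @ ss)" by (simp add: as_def r)
    define p where "p s = prod_list (map (\<lambda>a. sin ((s - a) / 2)) as)" for s
    \<comment> \<open>The factor \<open>- (\<epsilon> * \<sigma>)\<close> makes \<open>g\<close>
      oppose \<open>f\<close> both where \<open>f = \<epsilon>\<close> and where
      \<open>f = - \<epsilon>\<close>.\<close>
    define g where "g s = - (\<epsilon> * \<sigma>) * p s" for s
    define D where "D = smult (of_real (- (\<epsilon> * \<sigma>))) (sine_prod as)"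
    have rng: "x < a" "a < x + 2 * pi" if "a \<in> set ss" for a
    proof -
      show "x < a" using ss(2) [OF that] F(1) [of a0] \<epsilon>(2) by (auto simp: Z_def)
      show "a < x + 2 * pi" using ss(3) [OF that] F(2) by (fastforce simp: Z_def)
    qed
    have sgnp: "sgn (p s) = sgn (prod_list (map (\<lambda>a. s - a) ss))" if s: "s \<in> F" for s
    proof -
      have "sgn (p s) = sgn (prod_list (map (\<lambda>a. s - a) as))"
        unfolding p_def
      proof (rule sgn_sine_prod)
        fix a assume "a \<in> set as"
        hence "a = x \<or> a \<in> set ss" by (auto simp: as_def)
        thus "\<bar>s - a\<bar> < 2 * pi" using rng [of a] F(1,2) [OF s] by auto
      qed
      also have "prod_list (map (\<lambda>a. s - a) as) = (s - x) ^ (n - length ss) * prod_list (map (\<lambda>a. s - a) ss)"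
        by (simp add: as_def prod_list_replicate)
      also have "sgn \<dots> = sgn (prod_list (map (\<lambda>a. s - a) ss))" using F(1) [OF s] by (simp add: sgn_mult)
      finally show ?thesis .
    qed
    have e2: "\<epsilon> * \<epsilon> = 1" using \<epsilon>(1) by auto
    have False
    proof (rule no_descent [of D g])
      show "degree D \<le> n" unfolding D_def using degree_sine_prod [of as] len by (auto intro: order_trans [OF degree_smult_le])
      show "poly D (cis x) = 0" "poly (pderiv D) (cis x) = 0"
        unfolding D_def pderiv_smult poly_smult sine_prod_double_root [OF as2] by simp_all
      show "trig n D (of_real s) = of_real (g s)" for s
        using trig_sine_prod [of as s] unfolding D_def trig_smult len by (simp add: g_def p_def)
      fix s assume s: "s \<in> F" "\<bar>f s\<bar> = 1"
      have "s \<in> Z \<epsilon> \<union> Z (- \<epsilon>)" using fZ [OF s] ZZ by simp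
      thus "f s * g s < 0"
      proof
        assume z: "s \<in> Z \<epsilon>"
        have "sgn (\<sigma> * p s) = sgn (\<sigma> * prod_list (map (\<lambda>a. s - a) ss))" by (simp add: sgn_mult sgnp [OF s(1)])
        also have "\<dots> = 1" using ss(4) [OF z] by simp
        finally have "\<sigma> * p s > 0" by (simp add: sgn_1_pos)
        moreover have "f s * g s = - (\<epsilon> * \<epsilon>) * (\<sigma> * p s)" using z by (simp add: Z_def g_def)
        ultimately show ?thesis by (simp add: e2)
      next
        assume z: "s \<in> Z (- \<epsilon>)"
        have "sgn (\<sigma> * p s) = sgn (\<sigma> * prod_list (map (\<lambda>a. s - a) ss))" by (simp add: sgn_mult sgnp [OF s(1)])
        also have "\<dots> = - 1" using ss(5) [OF z] by simp
        finally have "\<sigma> * p s < 0" by (simp add: sgn_1_neg)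
        moreover have "f s * g s = (\<epsilon> * \<epsilon>) * (\<sigma> * p s)" using z by (simp add: Z_def g_def)
        ultimately show ?thesis by (simp add: e2)
      qed
    qed
    thus thesis ..
  qed
qed

section \<open>The comb of an extremal polynomial\<close>

theorem theorem3p3:
  fixes E :: "complex set" and x :: real and n :: nat
  assumes "finite_arc_union E" and "E \<subset> sphere 0 1" and "cis x \<notin> E" and "n \<ge> 1"
  shows "\<exists>(S :: (real \<times> real) set) (\<tau> :: complex \<Rightarrow> complex) (P :: complex poly).
     regular_comb_data n S \<and>
     \<tau> holomorphic_on upper_half_plane \<and>
     bij_betw \<tau> upper_half_plane (comb_domain S) \<and>
     continuous_on {z. Im z \<ge> 0} \<tau> \<and>
     (\<forall>z\<in>upper_half_plane.
        poly P (exp (\<i> * z)) = exp (\<i> * z * of_nat n / 2) * cos (of_nat n / 2 * \<tau> z)) \<and>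
     P \<in> Pn n E \<and> poly P (cis x) = 0 \<and>
     (\<forall>Q\<in>Pn n E. poly Q (cis x) = 0 \<longrightarrow>
        norm (poly (pderiv Q) (cis x)) \<le> norm (poly (pderiv P) (cis x))) \<and>
     A_n n (cis x) E = norm (poly (pderiv P) (cis x)) \<and>
     E \<subseteq> {cis t | t. Im (\<tau> (complex_of_real t)) = 0} \<and>
     (\<forall>k<n. \<exists>t::real. \<tau> (complex_of_real t) = complex_of_real (2 * pi * real k / real n) \<and> cis t \<in> E)"
proof -
  have E: "compact E" "infinite E" "E \<subseteq> sphere 0 1"
    using finite_arc_union_compact [OF assms(1)] assms(2) by auto
  obtain R where R: "R \<in> Pn n E" "poly R (cis x) = 0" "\<And>s::real. trig n R (of_real s) \<in> \<real>"
    "\<And>Q. Q \<in> Pn n E \<Longrightarrow> poly Q (cis x) = 0 \<Longrightarrow> norm (poly (pderiv Q) (cis x)) \<le> norm (poly (pderiv R) (cis x))"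
    using real_extremal_exists [OF E(3,2), of n x] by blast
  obtain t :: "nat \<Rightarrow> real" and \<epsilon> :: real where \<epsilon>: "\<epsilon> = 1 \<or> \<epsilon> = -1"
    and t: "\<And>j. j < n \<Longrightarrow> x < t j \<and> t j < x + 2 * pi \<and> cis (t j) \<in> E \<and> trig n R (of_real (t j)) = of_real (\<epsilon> * (-1) ^ j)"
    and tmono: "\<And>j. Suc j < n \<Longrightarrow> t j < t (Suc j)"
    by (rule extremal_alternates [OF E(1,3) assms(3,4) R]) (auto intro: that)
  \<comment> \<open>The sign lets the alternation start with the value 1, as
    \<open>alternating_poly\<close> demands.\<close>
  define P where "P = smult (of_real \<epsilon>) R"
  have trigP: "trig n P z = of_real \<epsilon> * trig n R z" for z by (simp add: P_def trig_smult)
  have normP: "norm (poly P w) = norm (poly R w)" "norm (poly (pderiv P) w) = norm (poly (pderiv R) w)" for w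
    using \<epsilon> by (auto simp: P_def pderiv_smult norm_mult)
  have P: "P \<in> Pn n E" "poly P (cis x) = 0"
    using R(1,2) by (auto simp: Pn_def normP, auto simp: P_def intro: order_trans [OF degree_smult_le])
  have max: "norm (poly (pderiv Q) (cis x)) \<le> norm (poly (pderiv P) (cis x))" if "Q \<in> Pn n E" "poly Q (cis x) = 0" for Q
    using R(4) that normP by simp
  have real: "trig n P (of_real s) \<in> \<real>" for s unfolding trigP using R(3) by simp
  \<comment> \<open>The first point, one period later, closes the list.\<close>
  define t' where "t' j = (if j < n then t j else t 0 + 2 * pi)" for j
  have alt: "trig n P (of_real (t' j)) = (-1) ^ j" if "j < n" for j
    using t [OF that] that \<epsilon> by (auto simp: t'_def trigP)
  have "alternating_poly n P t'"
  proof
    show "degree P \<le> n" using P(1) by (simp add: Pn_def)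
    show "t' j < t' (Suc j)" if "j < n" for j
      using tmono [of j] t [OF that] t [of 0] that assms(4) by (cases "Suc j < n") (auto simp: t'_def)
    show "t' n = t' 0 + 2 * pi" using assms(4) by (simp add: t'_def)
    show "trig n P (of_real (t' j)) = (-1) ^ j" if "j \<le> n" for j
    proof (cases "j < n")
      case False
      hence j: "j = n" using that by simp
      \<comment> \<open>The shift by \<open>2 * pi\<close> contributes \<open>(-1) ^ n\<close>,
        exactly the sign demanded at index \<open>n\<close>.\<close>
      have "complex_of_real (t' n) = of_real (t' 0) + 2 * of_real pi" using assms(4) by (simp add: t'_def)
      thus ?thesis using alt [of 0] assms(4) unfolding j by (simp add: trig_plus_2pi)
    qed (rule alt)
  qed (use assms(4) real in auto)
  then obtain S \<tau> where S: "regular_comb_data n S" "\<tau> holomorphic_on upper_half_plane"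
    "bij_betw \<tau> upper_half_plane (comb_domain S)" "continuous_on {z. Im z \<ge> 0} \<tau>"
    "\<And>z. Im z \<ge> 0 \<Longrightarrow> cos (of_nat n / 2 * \<tau> z) = trig n P z"
    "\<And>k. k < n \<Longrightarrow> \<tau> (of_real (t' k)) = complex_of_real (2 * pi * real k / real n)"
    using comb_representation by blast
  have form: "poly P (exp (\<i> * z)) = exp (\<i> * z * of_nat n / 2) * cos (of_nat n / 2 * \<tau> z)" if "z \<in> upper_half_plane" for z
  proof -
    have "cos (of_nat n / 2 * \<tau> z) = trig n P z" using S(5) [of z] that by (simp add: upper_half_plane_def)
    thus ?thesis using poly_eq_trig [of P z n] by (simp add: mult_ac)
  qed
  have An: "A_n n (cis x) E = norm (poly (pderiv P) (cis x))"
    unfolding A_n_def by (rule cSup_eq_maximum) (use P max in auto)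
  have base: "E \<subseteq> {cis t | t. Im (\<tau> (complex_of_real t)) = 0}"
  proof
    fix w assume w: "w \<in> E"
    hence "norm w = 1" using E(3) by auto
    then obtain s where s: "w = cis s" using norm_1_eq_cis by blast
    have c: "cos (of_nat n / 2 * \<tau> (of_real s)) = trig n P (of_real s)" using S(5) by simp
    have "Im (of_nat n / 2 * \<tau> (of_real s)) = 0"
      by (rule Im_eq_0_of_cos) (use c real norm_trig_of_real [of n P s] P(1) w s in \<open>auto simp: Pn_def\<close>)
    hence "Im (\<tau> (of_real s)) = 0" using assms(4) by simp
    thus "w \<in> {cis t | t. Im (\<tau> (complex_of_real t)) = 0}" using s by blast
  qed
  \<comment> \<open>The alternation point \<open>t k\<close> is itself a boundary preimage of the
    base point, on one side of the slit if there is one.\<close>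
  have "\<exists>s::real. \<tau> (complex_of_real s) = complex_of_real (2 * pi * real k / real n) \<and> cis s \<in> E" if "k < n" for k
    using S(6) [OF that] t [OF that] that by (intro exI [of _ "t k"]) (simp add: t'_def)
  thus ?thesis using S(1-4) form P max An base by (intro exI [of _ S] exI [of _ \<tau>] exI [of _ P]) blast
qed

end
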